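(* Let $n,k,w$ be integers with $k<w<kn$. The universal cycle $\mathcal{G}_k(n,w^\uparrow)$ can be unranked in $\mathcal{O}(n^4k^2\log k)$ time using $\mathcal{O}(n^3k)$ space; that is, there is an algorithm that, given any integer $r$ with $1\le r\le|\mathbf{S}_k(n,w^\uparrow)|$, outputs the length-$n$ (cyclic) substring of $\mathcal{G}_k(n,w^\uparrow)$ starting at index $r$ within these bounds.
   Context: $\mathbf{S}_k(n)$ is the set of length-$n$ strings over $\{\mathtt{1},\ldots,\mathtt{k}\}$; the weight of a string is the sum of its symbols; $\mathbf{S}_k(n,w^\uparrow)$ is the set of strings in $\mathbf{S}_k(n)$ with weight at least $w$. A necklace is a string that is lexicographically smallest among its rotations. $\mathbf{N}_k(n,w^\uparrow)=(\alpha_1,\ldots,\alpha_m)$ lists the necklaces in $\mathbf{S}_k(n,w^\uparrow)$ in lexicographic order. $\mathrm{ap}(\mathbf{s})$ is the shortest string $\mathbf{t}$ with $\mathbf{s}=\mathbf{t}^j$ for some $j\ge1$. $\mathcal{G}_k(n,w^\uparrow)=\mathrm{ap}(\alpha_1)\mathrm{ap}(\alpha_2)\cdots\mathrm{ap}(\alpha_m)$, regarded as a cyclic sequence (indices $1$ to its length, wrapping around); it is known to be a universal cycle for $\mathbf{S}_k(n,w^\uparrow)$, i.e., a cyclic sequence of length $|\mathbf{S}_k(n,w^\uparrow)|$ in which every string of $\mathbf{S}_k(n,w^\uparrow)$ occurs exactly once as a cyclic substring. Complexity is in the unit-cost RAM model. *)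

theory Defs
  imports Complex_Main "HOL-Library.List_Lexorder"
begin

definition strings :: "nat \<Rightarrow> nat \<Rightarrow> nat list set" where
  "strings k n = {s. length s = n \<and> set s \<subseteq> {1..k}}"

definition weight :: "nat list \<Rightarrow> nat" where
  "weight s = sum_list s"

definition strings_ge :: "nat \<Rightarrow> nat \<Rightarrow> nat \<Rightarrow> nat list set" where
  "strings_ge k n w = {s \<in> strings k n. w \<le> weight s}"

text \<open>The order on lists is the lexicographic one of \<^theory>\<open>HOL-Library.List_Lexorder\<close>.\<close>

definition necklace :: "nat list \<Rightarrow> bool" where
  "necklace s \<longleftrightarrow> (\<forall>i. s \<le> rotate i s)"

definition necklace_list :: "nat \<Rightarrow> nat \<Rightarrow> nat \<Rightarrow> nat list list" where
  "necklace_list k n w = sorted_list_of_set {s \<in> strings_ge k n w. necklace s}"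

definition ap :: "'a list \<Rightarrow> 'a list" where
  "ap s = (ARG_MIN length t. \<exists>j\<ge>1. s = concat (replicate j t))"

definition ucycle :: "nat \<Rightarrow> nat \<Rightarrow> nat \<Rightarrow> nat list" where
  "ucycle k n w = concat (map ap (necklace_list k n w))"

text \<open>The starting index \<open>r\<close> is counted from 1, whereas \<open>!\<close> counts from 0. The cyclic
  sequence may be shorter than \<open>n\<close> (for \<open>k = 1\<close>), in which case it is traversed repeatedly.\<close>

definition cyclic_substring :: "'a list \<Rightarrow> nat \<Rightarrow> nat \<Rightarrow> 'a list" where
  "cyclic_substring g r n = map (\<lambda>i. g ! ((r - 1 + i) mod length g)) [0..<n]"


text \<open>A unit-cost random access machine. Registers are indexed by, and contain, arbitrary natural numbers. Subtraction is truncated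
  at 0, division is integer division (with result 0 for divisor 0). The target register comes
  first; the source of \<open>Load\<close> and the target of \<open>Store\<close> are addressed indirectly.\<close>

datatype instr =
    Const nat nat
  | Copy nat nat
  | Load nat nat
  | Store nat nat
  | Add nat nat nat
  | Sub nat nat nat
  | Mult nat nat nat
  | Div nat nat nat
  | Jump nat
  | JumpZero nat nat
  | Write nat

type_synonym program = "instr list"

record config =
  pc :: nat
  regs :: "nat \<Rightarrow> nat"
  out :: "nat list"

definition set_reg :: "nat \<Rightarrow> nat \<Rightarrow> config \<Rightarrow> config" where
  "set_reg a v c = c\<lparr>pc := Suc (pc c), regs := (regs c)(a := v)\<rparr>"

fun exec :: "instr \<Rightarrow> config \<Rightarrow> config" where
  "exec (Const a v) c = set_reg a v c"
| "exec (Copy a b) c = set_reg a (regs c b) c"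
| "exec (Load a b) c = set_reg a (regs c (regs c b)) c"
| "exec (Store a b) c = set_reg (regs c a) (regs c b) c"
| "exec (Add a b d) c = set_reg a (regs c b + regs c d) c"
| "exec (Sub a b d) c = set_reg a (regs c b - regs c d) c"
| "exec (Mult a b d) c = set_reg a (regs c b * regs c d) c"
| "exec (Div a b d) c = set_reg a (regs c b div regs c d) c"
| "exec (Jump l) c = c\<lparr>pc := l\<rparr>"
| "exec (JumpZero a l) c = c\<lparr>pc := (if regs c a = 0 then l else Suc (pc c))\<rparr>"
| "exec (Write a) c = c\<lparr>pc := Suc (pc c), out := out c @ [regs c a]\<rparr>"

fun accessed :: "instr \<Rightarrow> config \<Rightarrow> nat set" where
  "accessed (Const a v) c = {a}"
| "accessed (Copy a b) c = {a, b}"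
| "accessed (Load a b) c = {a, b, regs c b}"
| "accessed (Store a b) c = {a, b, regs c a}"
| "accessed (Add a b d) c = {a, b, d}"
| "accessed (Sub a b d) c = {a, b, d}"
| "accessed (Mult a b d) c = {a, b, d}"
| "accessed (Div a b d) c = {a, b, d}"
| "accessed (Jump l) c = {}"
| "accessed (JumpZero a l) c = {a}"
| "accessed (Write a) c = {a}"

definition halted :: "program \<Rightarrow> config \<Rightarrow> bool" where
  "halted P c \<longleftrightarrow> length P \<le> pc c"

definition step :: "program \<Rightarrow> config \<Rightarrow> config" where
  "step P c = (if halted P c then c else exec (P ! pc c) c)"

text \<open>The input is placed in the first registers; all others are initially 0.\<close>

definition init :: "nat list \<Rightarrow> config" where
  "init xs = \<lparr>pc = 0, regs = (\<lambda>i. if i < length xs then xs ! i else 0), out = []\<rparr>"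

definition run :: "program \<Rightarrow> nat list \<Rightarrow> nat \<Rightarrow> config" where
  "run P xs t = (step P ^^ t) (init xs)"

text \<open>On input \<open>xs\<close>, the program halts with output \<open>ys\<close> after exactly \<open>t\<close> steps. The space is
  \<open>s\<close> if the input registers and all registers accessed lie among the first \<open>s\<close> ones. This
  bounds the number of registers used, and prevents a program from saving space by spreading its
  data over a huge address range.\<close>

definition computes_in ::
    "program \<Rightarrow> nat list \<Rightarrow> nat list \<Rightarrow> nat \<Rightarrow> nat \<Rightarrow> bool" where
  "computes_in P xs ys t s \<longleftrightarrow>
     halted P (run P xs t) \<and> out (run P xs t) = ys \<and>
     (\<forall>i<t. \<not> halted P (run P xs i)) \<and>
     length xs \<le> s \<and>
     (\<forall>i<t. accessed (P ! pc (run P xs i)) (run P xs i) \<subseteq> {..<s})"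

end

theory Submission
  imports Defs
begin

text \<open>
  To find the symbol at a given position, determine the necklace containing that position digit by
  digit; this needs, for a prefix \<open>q\<close> of a necklace, the number of strings all of whose rotations
  have a prefix lexicographically larger than \<open>q\<close>. Such cyclic strings factor uniquely into blocks,
  each a proper prefix of \<open>q\<close> followed by a letter exceeding the next letter of \<open>q\<close>. Hence, with
  \<open>\<beta>(z)\<close> the generating function of the blocks, weighted by powers of a large \<open>B\<close> to record string
  weights, the number of these strings of length \<open>n\<close> is the coefficient of \<open>z\<^sup>n\<close> in
  \<open>z \<beta>'(z) / (1 - \<beta>(z))\<close>. Since registers hold arbitrary numbers at unit cost, this coefficient is
  obtained by one integer division at \<open>z = 1 / Z\<close> for a large power \<open>Z\<close> of \<open>B\<close>, and the strings of
  weight at least \<open>w\<close> among those counted are extracted by dividing by \<open>B\<^sup>w\<close> and reducing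
  modulo \<open>B - 1\<close>.
\<close>

section \<open>Cyclic words over suffix-closed prefix codes\<close>

text \<open>The rotation class of a necklace \<open>s\<close> has \<open>length (ap s)\<close>
  members, so the necklaces above \<open>s\<close> fill a final stretch of the cycle whose length is
  the number of strings with minimal rotation above \<open>s\<close>. Hence positions are counted
  from the end. A block is what a rotation reads up to its first deviation from \<open>q\<close>.
  For arbitrary \<open>q\<close> a suffix of a block need not begin with a block; for a prefix of a
  necklace it does, since every suffix of \<open>q\<close> is at least the prefix of the same
  length. Together with prefix-freeness this makes the cyclic factorization exist and be unique.
  Marking a position within one block gives \<open>z \<beta>'(z)\<close>, and the remaining blocks
  give \<open>1 / (1 - \<beta>(z))\<close>. As \<open>B - 1\<close> exceeds the number of strings,
  residues modulo \<open>B - 1\<close> are exact counts. The cost comes from \<open>n\<close>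
  symbols, \<open>n\<close> digits each, at most \<open>k\<close> candidates per digit, and for each
  candidate some powers with exponents of order \<open>n k\<close>, computed by repeated
  multiplication.\<close>

locale suffix_code =
  fixes X :: "'a list set"
  assumes nonempty: "[] \<notin> X"
    and prefix_free: "\<lbrakk>u \<in> X; u @ v \<in> X\<rbrakk> \<Longrightarrow> v = []"
    and suffix_begins: "\<lbrakk>x @ y \<in> X; y \<noteq> []\<rbrakk> \<Longrightarrow> \<exists>z \<in> X. \<exists>y'. y = z @ y'"
begin

inductive_set star :: "'a list set" where
  Nil: "[] \<in> star"
| Cons: "\<lbrakk>u \<in> X; v \<in> star\<rbrakk> \<Longrightarrow> u @ v \<in> star"

definition begins :: "'a list \<Rightarrow> bool" where
  "begins y \<longleftrightarrow> (\<exists>z \<in> X. \<exists>y'. y = z @ y')"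

definition cyclic :: "'a list \<Rightarrow> bool" where
  "cyclic t \<longleftrightarrow> (\<forall>i. begins (rotate i t))"

text \<open>A triple \<open>(i, u, v)\<close> encodes the cyclic word \<open>u @ v\<close> read from offset \<open>i\<close> of its first block
  \<open>u\<close>, so that \<open>u\<close> is the block that contains the starting position.\<close>

definition pointed :: "nat \<Rightarrow> (nat \<times> 'a list \<times> 'a list) set" where
  "pointed n = {(i, u, v). i < length u \<and> u \<in> X \<and> v \<in> star \<and> length u + length v = n}"

definition unpoint :: "nat \<times> 'a list \<times> 'a list \<Rightarrow> 'a list" where
  "unpoint = (\<lambda>(i, u, v). rotate i (u @ v))"

lemma star_append: "x \<in> star \<Longrightarrow> y \<in> star \<Longrightarrow> x @ y \<in> star"
  by (induction rule: star.induct) (auto intro: star.intros)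

lemma X_star: "u \<in> X \<Longrightarrow> u \<in> star"
  using star.Cons[OF _ star.Nil] by simp

text \<open>Cutting off the block with which a nonempty suffix begins leaves a shorter suffix of the
  same block, so \<open>suffix_begins\<close> extends to a full factorization.\<close>

lemma suffix_X_star: "x @ y \<in> X \<Longrightarrow> y \<in> star"
proof (induction "length y" arbitrary: x y rule: less_induct)
  case less
  show ?case
  proof (cases "y = []")
    case False
    then obtain z y' where z: "z \<in> X" "y = z @ y'"
      using suffix_begins less.prems by blast
    moreover have "length y' < length y"
      using z nonempty by (cases z) auto
    moreover have "(x @ z) @ y' \<in> X"
      using less.prems z by simp
    ultimately show ?thesis
      using less.hyps star.Cons by blast
  qed (simp add: star.Nil)
qed

lemma star_suffix: "x @ y \<in> star \<Longrightarrow> y \<in> star"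
proof (induction "x @ y" arbitrary: x y rule: star.induct)
  case (Cons u v)
  from Cons(4) consider us where "v = us @ y" | us where "u = x @ us" "us @ v = y"
    by (auto simp: append_eq_append_conv2)
  then show ?case
  proof cases
    case 2
    then have "us \<in> star"
      using suffix_X_star Cons(1) by blast
    then show ?thesis
      using star_append Cons(2) 2 by blast
  qed (use Cons(3) in blast)
qed (simp add: star.Nil)

lemma star_begins: "y \<in> star \<Longrightarrow> y \<noteq> [] \<Longrightarrow> begins y"
  by (auto simp: begins_def elim: star.cases)

lemma decode: "\<lbrakk>u \<in> X; u' \<in> X; u @ v = u' @ v'\<rbrakk> \<Longrightarrow> u = u' \<and> v = v'"
  using prefix_free by (fastforce simp: append_eq_append_conv2)

lemma rotate_append_split: "j \<le> length x \<Longrightarrow> rotate j (x @ y) = drop j x @ y @ take j x"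
  by (cases "j = length (x @ y)") (auto simp: rotate_drop_take)

lemma rotate_inj: "rotate i x = rotate i y \<Longrightarrow> x = y"
proof (induction i)
  case (Suc i)
  have "length (rotate (Suc i) x) = length (rotate (Suc i) y)"
    using Suc.prems by simp
  then have "length (rotate i x) = length (rotate i y)"
    by simp
  then have "rotate i x = rotate i y"
    using Suc.prems by (cases "rotate i x"; cases "rotate i y") auto
  then show ?case
    by (rule Suc.IH)
qed simp

text \<open>If the offsets differed by \<open>e > 0\<close>, then \<open>take e u\<close> would end
  a word of \<open>star\<close>, hence begin with a block; as a proper prefix of \<open>u\<close>
  that block contradicts prefix-freeness.\<close>

lemma unpoint_inj_aux:
  assumes "u \<in> X" "v \<in> star" "i < length u" "u' \<in> X" "v' \<in> star" "i' \<le> i"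
    and eq: "rotate i (u @ v) = rotate i' (u' @ v')"
  shows "i = i' \<and> u = u' \<and> v = v'"
proof -
  define e where "e = i - i'"
  have "rotate i' (rotate e (u @ v)) = rotate i' (u' @ v')"
    using eq \<open>i' \<le> i\<close> by (simp only: rotate_rotate e_def le_add_diff_inverse)
  then have uv: "u' @ v' = rotate e (u @ v)"
    by (rule rotate_inj[symmetric])
  show ?thesis
  proof (cases "e = 0")
    case True
    then show ?thesis
      using uv decode[of u u' v v'] \<open>u \<in> X\<close> \<open>u' \<in> X\<close> \<open>i' \<le> i\<close> by (simp add: e_def)
  next
    case False
    have e: "e < length u"
      using \<open>i < length u\<close> by (simp add: e_def)
    then have "u' @ v' = (drop e u @ v) @ take e u"
      using uv by (simp add: rotate_append_split)
    then have "(drop e u @ v) @ take e u \<in> star"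
      using star.Cons[OF \<open>u' \<in> X\<close> \<open>v' \<in> star\<close>] by simp
    then have "take e u \<in> star"
      by (rule star_suffix)
    moreover have "take e u \<noteq> []"
      using e False by auto
    ultimately obtain z z' where "z \<in> X" "take e u = z @ z'"
      using star_begins begins_def by blast
    moreover from this have "u = z @ (z' @ drop e u)"
      using append_take_drop_id[of e u] by simp
    ultimately have "z' @ drop e u = []"
      using prefix_free[of z "z' @ drop e u"] \<open>u \<in> X\<close> by simp
    then show ?thesis
      using e by simp
  qed
qed

lemma inj_on_unpoint: "inj_on unpoint (pointed n)"
proof (rule inj_onI, clarsimp simp: unpoint_def pointed_def)
  fix i u v i' u' v'
  assume "i < length u" "u \<in> X" "v \<in> star" "i' < length u'" "u' \<in> X" "v' \<in> star"
    "rotate i (u @ v) = rotate i' (u' @ v')"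
  then show "i = i' \<and> u = u' \<and> v = v'"
    using unpoint_inj_aux[of u v i u' v' i'] unpoint_inj_aux[of u' v' i' u v i]
    by (cases "i' \<le> i") auto
qed

text \<open>A whole first block can be moved to the end without leaving \<open>star\<close>; this is
  repeated until the offset falls inside the first block.\<close>

lemma star_rotate_pointed:
  "\<lbrakk>w \<in> star; s < length w\<rbrakk> \<Longrightarrow> rotate s w \<in> unpoint ` pointed (length w)"
proof (induction s arbitrary: w rule: less_induct)
  case (less s)
  from less.prems obtain u v where w: "w = u @ v" "u \<in> X" "v \<in> star"
    by (auto elim: star.cases)
  show ?case
  proof (cases "s < length u")
    case True
    then show ?thesis
      using w by (auto simp: pointed_def unpoint_def intro!: image_eqI[where x = "(s, u, v)"])
  next
    case False
    have "u \<noteq> []"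
      using w nonempty by auto
    moreover have "v @ u \<in> star"
      using w star_append X_star by auto
    ultimately have "rotate (s - length u) (v @ u) \<in> unpoint ` pointed (length (v @ u))"
      using less.prems w False
      by (intro less.IH) (auto simp: not_less intro!: diff_less order.strict_trans2[of 0 "length u" s])
    moreover have "rotate (s - length u) (v @ u) = rotate s w"
      using rotate_append[of u v] rotate_rotate[of "s - length u" "length u" w] False w by simp
    ultimately show ?thesis
      using w by (simp add: add.commute)
  qed
qed

text \<open>With \<open>inj_on_unpoint\<close> this is unique cyclic factorization. One inclusion is
  easy: suffixes of words of \<open>star\<close> stay in \<open>star\<close>, so every rotation
  begins with a block.\<close>

lemma cyclic_eq_pointed:
  assumes "n > 0"
  shows "{t. length t = n \<and> cyclic t} = unpoint ` pointed n"
proof (intro set_eqI iffI)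
  fix t
  assume "t \<in> unpoint ` pointed n"
  then obtain i u v where iuv: "i < length u" "u \<in> X" "v \<in> star" "length u + length v = n"
      "t = rotate i (u @ v)"
    by (auto simp: pointed_def unpoint_def)
  define w where "w = u @ v"
  have w: "w \<in> star" "w \<noteq> []"
    using iuv star.Cons by (auto simp: w_def)
  have "begins (rotate j w)" for j
  proof -
    let ?j = "j mod length w"
    have j: "?j < length w"
      using w by simp
    have "drop ?j w \<in> star"
      using w star_suffix[of "take ?j w" "drop ?j w"] by simp
    then have "begins (drop ?j w)"
      using star_begins j by simp
    then have "begins (drop ?j w @ take ?j w)"
      unfolding begins_def by (metis append.assoc)
    then show ?thesis
      by (simp add: rotate_drop_take)
  qed
  then show "t \<in> {t. length t = n \<and> cyclic t}"
    using iuv by (simp add: cyclic_def w_def[symmetric] rotate_rotate) (simp add: w_def)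
next
  fix t
  assume "t \<in> {t. length t = n \<and> cyclic t}"
  then have len: "length t = n" and cyc: "cyclic t"
    by auto
  \<comment> \<open>After the longest block that begins a rotation, the rest of the cyclic word must factor: a
    block overrunning its end would contain the longest block properly.\<close>
  define L where "L = {length u | u. u \<in> X \<and> (\<exists>s y. rotate s t = u @ y)}"
  have "L \<subseteq> {..n}"
  proof (clarsimp simp: L_def)
    fix s u y assume "rotate s t = u @ y"
    then show "length u \<le> n"
      using len by (metis length_append length_rotate le_add1)
  qed
  then have fin: "finite L"
    using finite_subset by blast
  have "L \<noteq> {}"
    using cyc unfolding L_def cyclic_def begins_def by blast
  then have "Max L \<in> L"
    using fin by (rule Max_in[rotated])
  then obtain u s y where u: "u \<in> X" "rotate s t = u @ y" "length u = Max L"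
    by (auto simp: L_def)
  have "x @ y' = y \<Longrightarrow> y' \<in> star" for x y'
  proof (induction "length y'" arbitrary: x y' rule: less_induct)
    case less
    show ?case
    proof (cases "y' = []")
      case False
      have "rotate (length (u @ x)) ((u @ x) @ y') = y' @ u @ x"
        by (simp only: rotate_append)
      then have rot: "rotate (length (u @ x) + s) t = y' @ u @ x"
        using less.prems u by (simp add: rotate_rotate[symmetric])
      then obtain z r where z: "z \<in> X" "y' @ u @ x = z @ r"
        using cyc unfolding cyclic_def begins_def by metis
      obtain us where "y' = z @ us \<or> z = y' @ us \<and> u @ x = us @ r"
        using z(2) unfolding append_eq_append_conv2[of y'] by metis
      then consider z' where "z = y' @ z'" "z' \<noteq> []" "z' @ r = u @ x" | y'' where "y' = z @ y''"
        by (cases "us = []") auto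
      then show ?thesis
      proof cases
        case 1
        \<comment> \<open>The overrun \<open>z'\<close> is a nonempty suffix of the block
          \<open>z\<close>, so it begins with a block; this block and \<open>u\<close> are both
          prefixes of \<open>u @ x\<close>, hence equal.\<close>
        obtain z2 z3 where z2: "z2 \<in> X" "z' = z2 @ z3"
          using suffix_begins z 1 by blast
        then have "z2 @ (z3 @ r) = u @ x"
          using 1 by simp
        then have "z2 = u"
          using decode u z2 by blast
        then have "length z > length u"
          using 1 z2 False by simp
        moreover have "length z \<in> L"
          using z rot by (auto simp: L_def)
        ultimately show ?thesis
          using Max_ge[OF fin] u by fastforce
      next
        case 2
        have "(x @ z) @ y'' = y"
          using less.prems 2 by simp
        moreover have "length y'' < length y'"
          using 2 z nonempty by (cases z) auto
        ultimately have "y'' \<in> star"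
          using less.hyps by blast
        then show ?thesis
          using star.Cons z 2 by simp
      qed
    qed (simp add: star.Nil)
  qed
  from this[of "[]" y] have w: "u @ y \<in> star"
    using star.Cons u by simp
  define s' where "s' = (n - s mod n) mod n"
  have "rotate (n - s mod n) (rotate (s mod n) t) = t"
  proof -
    have "s mod n < n"
      using assms by simp
    then show ?thesis
      using len by (simp add: rotate_rotate rotate_id)
  qed
  moreover have uy: "length (u @ y) = n"
    using u len by (metis length_rotate)
  ultimately have "rotate s' (u @ y) = t"
    using u len rotate_conv_mod[of s t] rotate_conv_mod[of "n - s mod n" "u @ y"]
    by (simp add: s'_def)
  moreover have "s' < n"
    using assms by (simp add: s'_def)
  ultimately show "t \<in> unpoint ` pointed n"
    using star_rotate_pointed[OF w, of s'] uy by auto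
qed

end

section \<open>Weighted generating function of cyclic words\<close>

lemma sum_list_rotate: "sum_list (rotate i t) = sum_list (t :: 'a :: comm_monoid_add list)"
  unfolding rotate_drop_take sum_list_append
  by (metis add.commute append_take_drop_id sum_list_append)

locale weighted_code = suffix_code X for X :: "nat list set" +
  fixes B :: nat
  assumes finite_X: "finite X"
begin

definition pointed_weight :: "nat \<Rightarrow> nat" where
  "pointed_weight n = (\<Sum>(i, u, v)\<in>pointed n. B ^ (sum_list u + sum_list v))"

lemma star_letters: "v \<in> star \<Longrightarrow> set v \<subseteq> \<Union> (set ` X)"
  by (induction rule: star.induct) auto

lemma finite_pointed: "finite (pointed n)"
proof -
  let ?V = "{v. set v \<subseteq> \<Union> (set ` X) \<and> length v \<le> n}"
  have "finite ?V"
    using finite_X by (intro finite_lists_length_le) auto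
  then have "finite ({..<n} \<times> X \<times> ?V)"
    using finite_X by simp
  moreover have "pointed n \<subseteq> {..<n} \<times> X \<times> ?V"
    using star_letters by (auto simp: pointed_def)
  ultimately show ?thesis
    using finite_subset by blast
qed

lemma pointed_split:
  "pointed n = (\<lambda>(u, i). (i, u, [])) ` (SIGMA u:{u \<in> X. length u = n}. {..<n}) \<union>
     (\<lambda>(x, i, u, v). (i, u, x @ v)) ` (SIGMA x:{x \<in> X. length x \<le> n}. pointed (n - length x))"
    (is "_ = ?P \<union> ?Q")
proof (intro equalityI subsetI)
  fix p assume "p \<in> pointed n"
  then obtain i u v where p: "p = (i, u, v)" "i < length u" "u \<in> X" "v \<in> star"
      "length u + length v = n"
    by (auto simp: pointed_def)
  from p(4) show "p \<in> ?P \<union> ?Q"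
  proof cases
    case Nil
    then show ?thesis
      using p by force
  next
    case (Cons x v')
    then have "(x, i, u, v') \<in> (SIGMA x:{x \<in> X. length x \<le> n}. pointed (n - length x))"
      using p by (auto simp: pointed_def)
    then show ?thesis
      using p Cons by force
  qed
next
  fix p assume "p \<in> ?P \<union> ?Q"
  then show "p \<in> pointed n"
    by (auto simp: pointed_def intro: star.intros)
qed

text \<open>Coefficientwise form of \<open>A = z \<beta>' + \<beta> A\<close>: a lone block of
  length \<open>n\<close> can be marked at \<open>n\<close> positions; otherwise the first unmarked
  block is removed and contributes its weight as a factor.\<close>

lemma pointed_weight_rec:
  "pointed_weight n =
     (\<Sum>u\<in>X. if length u = n then n * B ^ sum_list u else 0) +
     (\<Sum>u\<in>X. if length u \<le> n then B ^ sum_list u * pointed_weight (n - length u) else 0)"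
proof -
  let ?f = "\<lambda>(i::nat, u, v). B ^ (sum_list u + sum_list v)"
  let ?S1 = "SIGMA u:{u \<in> X. length u = n}. {..<n}"
  let ?S2 = "SIGMA x:{x \<in> X. length x \<le> n}. pointed (n - length x)"
  let ?g1 = "\<lambda>(u, i). (i, u, [])"
  let ?g2 = "\<lambda>(x, i, u, v). (i, u, x @ v)"
  have fin: "finite ?S1" "finite ?S2"
    using finite_X finite_pointed by auto
  have "?g1 ` ?S1 \<inter> ?g2 ` ?S2 = {}"
    using nonempty by auto
  then have "pointed_weight n = sum ?f (?g1 ` ?S1) + sum ?f (?g2 ` ?S2)"
    using fin unfolding pointed_weight_def
    by (subst pointed_split) (intro sum.union_disjoint finite_imageI)
  moreover have "sum ?f (?g1 ` ?S1) = (\<Sum>u\<in>X. if length u = n then n * B ^ sum_list u else 0)"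
  proof -
    have "inj_on ?g1 ?S1"
      by (auto simp: inj_on_def)
    then have "sum ?f (?g1 ` ?S1) = (\<Sum>(u, i)\<in>?S1. B ^ sum_list u)"
      by (subst sum.reindex) (auto intro!: sum.cong)
    also have "\<dots> = (\<Sum>u\<in>{u \<in> X. length u = n}. n * B ^ sum_list u)"
      using finite_X by (subst sum.Sigma[symmetric]) auto
    finally show ?thesis
      using finite_X by (simp add: sum.inter_filter)
  qed
  moreover have "sum ?f (?g2 ` ?S2) =
      (\<Sum>u\<in>X. if length u \<le> n then B ^ sum_list u * pointed_weight (n - length u) else 0)"
  proof -
    have "inj_on ?g2 ?S2"
      by (rule inj_onI) (auto dest: decode)
    then have "sum ?f (?g2 ` ?S2) =
        (\<Sum>(x, i, u, v)\<in>?S2. B ^ sum_list x * B ^ (sum_list u + sum_list v))"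
      by (subst sum.reindex) (auto intro!: sum.cong simp: power_add)
    also have "\<dots> = (\<Sum>x\<in>{x \<in> X. length x \<le> n}. \<Sum>(i, u, v)\<in>pointed (n - length x).
        B ^ sum_list x * B ^ (sum_list u + sum_list v))"
      using finite_X finite_pointed by (subst sum.Sigma[symmetric]) (auto simp: case_prod_beta)
    also have "\<dots> = (\<Sum>x\<in>{x \<in> X. length x \<le> n}. B ^ sum_list x * pointed_weight (n - length x))"
      by (simp add: pointed_weight_def sum_distrib_left case_prod_beta)
    finally show ?thesis
      using finite_X by (simp add: sum.inter_filter)
  qed
  ultimately show ?thesis
    by simp
qed

lemma pointed_weight_eq:
  assumes "n > 0"
  shows "pointed_weight n = (\<Sum>t\<in>{t. length t = n \<and> cyclic t}. B ^ sum_list t)"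
proof -
  have "(\<Sum>t\<in>unpoint ` pointed n. B ^ sum_list t) = pointed_weight n"
    unfolding pointed_weight_def
    by (subst sum.reindex[OF inj_on_unpoint]) (auto intro!: sum.cong simp: unpoint_def sum_list_rotate)
  then show ?thesis
    using cyclic_eq_pointed[OF assms] by simp
qed

lemma cyclic_letters:
  assumes "t \<noteq> []" "cyclic t"
  shows "set t \<subseteq> \<Union> (set ` X)"
proof -
  have "t \<in> unpoint ` pointed (length t)"
    using cyclic_eq_pointed[of "length t"] assms by auto
  then show ?thesis
    using star_letters by (fastforce simp: unpoint_def pointed_def)
qed

lemma pointed_weight_0 [simp]: "pointed_weight 0 = 0"
  unfolding pointed_weight_def pointed_def by (rule sum.neutral) auto

end

section \<open>Blocks determined by a prefix of a necklace\<close>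

definition blocks :: "nat \<Rightarrow> nat list \<Rightarrow> nat list set" where
  "blocks k q = (\<lambda>(j, a). take j q @ [a]) ` (SIGMA j:{..<length q}. {q ! j<..k})"

definition block_weight :: "nat \<Rightarrow> nat \<Rightarrow> nat list \<Rightarrow> nat \<Rightarrow> nat" where
  "block_weight k B q j = (\<Sum>a\<in>{q ! j<..k}. B ^ (sum_list (take j q) + a))"

text \<open>Every suffix of \<open>q\<close> is at least the prefix of the same length, expressed by
  first mismatches because these are what end a block.\<close>

definition prenecklace :: "nat list \<Rightarrow> bool" where
  "prenecklace q \<longleftrightarrow>
     (\<forall>b j. b + j < length q \<longrightarrow> (\<forall>i<j. q ! (b + i) = q ! i) \<longrightarrow> q ! j \<le> q ! (b + j))"

lemma inj_on_blocks:
  "inj_on (\<lambda>(j, a). take j q @ [a]) (SIGMA j:{..<length q}. {q ! j<..k})"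
proof (rule inj_onI, clarsimp)
  fix j a j' assume "j < length q" "j' < length q" "take j q = take j' q"
  then show "j = j'"
    by (metis length_take min.absorb4)
qed

lemma sum_blocks:
  "(\<Sum>u\<in>blocks k q. f u) = (\<Sum>j<length q. \<Sum>a\<in>{q ! j<..k}. f (take j q @ [a]))"
  unfolding blocks_def sum.reindex[OF inj_on_blocks]
  by (subst sum.Sigma) (auto simp: case_prod_beta)

lemma begins_with_block_iff:
  "(\<exists>z\<in>blocks k q. \<exists>y'. y = z @ y') \<longleftrightarrow>
     (\<exists>j<length q. j < length y \<and> take j y = take j q \<and> q ! j < y ! j \<and> y ! j \<le> k)"
    (is "?L \<longleftrightarrow> ?R")
proof
  assume ?L
  then show ?R
    unfolding blocks_def by (fastforce simp: nth_append)
next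
  assume ?R
  then obtain j where j: "j < length q" "j < length y" "take j y = take j q" "q ! j < y ! j" "y ! j \<le> k"
    by blast
  then have "y = (take j q @ [y ! j]) @ drop (Suc j) y"
    by (simp add: id_take_nth_drop[symmetric] flip: j(3))
  then show ?L
    using j unfolding blocks_def by force
qed

text \<open>Prefix-freeness: the last letter of a block exceeds the letter of \<open>q\<close> that
  a longer block has there. Suffixes: the first mismatch of a shifted \<open>q\<close> with
  \<open>q\<close> is upwards by \<open>prenecklace\<close>; without a mismatch, the last letter
  \<open>a\<close> exceeds \<open>q ! j\<close>, which is at least
  \<open>q ! (j - b)\<close>.\<close>

lemma suffix_code_blocks:
  assumes "prenecklace q" "set q \<subseteq> {..k}"
  shows "suffix_code (blocks k q)"
proof
  show "[] \<notin> blocks k q"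
    by (auto simp: blocks_def)
next
  fix u v assume "u \<in> blocks k q" "u @ v \<in> blocks k q"
  then obtain j a j' a' where j: "u = take j q @ [a]" "j < length q" "q ! j < a"
      and j': "u @ v = take j' q @ [a']" "j' < length q"
    by (auto simp: blocks_def)
  have "\<not> j < j'"
  proof
    assume "j < j'"
    then have "(take j q @ a # v) ! j = (take j' q @ [a']) ! j"
      using j j' by simp
    then show False
      using j j' \<open>j < j'\<close> by (simp add: nth_append)
  qed
  moreover have "length (u @ v) = Suc j'"
    using j' by simp
  ultimately have "length v = 0"
    using j by auto
  then show "v = []"
    by simp
next
  fix x y assume xy: "x @ y \<in> blocks k q" "y \<noteq> []"
  then obtain j a where j: "x @ y = take j q @ [a]" "j < length q" "q ! j < a" "a \<le> k"
    by (auto simp: blocks_def)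
  define b where "b = length x"
  have len: "b + length y = Suc j"
    using arg_cong[OF j(1), of length] j(2) by (simp add: b_def)
  then have b: "b \<le> j" "length y = Suc (j - b)"
    using xy(2) by (cases y; simp)+
  have y: "y ! i = (if b + i = j then a else q ! (b + i))" if "i < length y" for i
  proof -
    have "y ! i = (take j q @ [a]) ! (b + i)"
      by (simp add: j(1)[symmetric] b_def)
    then show ?thesis
      using that len j(2) by (auto simp: nth_append)
  qed
  show "\<exists>z\<in>blocks k q. \<exists>y'. y = z @ y'"
  proof (cases "\<exists>i. b + i < j \<and> q ! (b + i) \<noteq> q ! i")
    case True
    define i where "i = (LEAST i. b + i < j \<and> q ! (b + i) \<noteq> q ! i)"
    have i: "b + i < j" "q ! (b + i) \<noteq> q ! i"
      using LeastI_ex[OF True] by (simp_all add: i_def)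
    have less: "q ! (b + i') = q ! i'" if "i' < i" for i'
      using not_less_Least[of i' "\<lambda>i. b + i < j \<and> q ! (b + i) \<noteq> q ! i"] that i(1)
      by (auto simp: i_def)
    have "q ! i \<le> q ! (b + i)"
      using assms i(1) j(2) less unfolding prenecklace_def by simp
    then have "q ! i < y ! i"
      using i y[of i] b by simp
    moreover have "take i y = take i q"
      using less i b j(2) y by (intro nth_equalityI) auto
    moreover have "y ! i \<le> k"
      using i b j(2) y[of i] subsetD[OF assms(2) nth_mem[of "b + i" q]] by auto
    ultimately show ?thesis
      using i b j(2) unfolding begins_with_block_iff by (intro exI[of _ i]) auto
  next
    case False
    then have "q ! (j - b) \<le> q ! (b + (j - b))"
      using assms j(2) b(1) unfolding prenecklace_def by (metis add.commute le_add_diff_inverse less_diff_conv)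
    moreover have "take (j - b) y = take (j - b) q"
      using False b j(2) y by (intro nth_equalityI) auto
    ultimately show ?thesis
      using j b y[of "j - b"] unfolding begins_with_block_iff by (intro exI[of _ "j - b"]) auto
  qed
qed

section \<open>Extracting coefficients by integer division\<close>

text \<open>The terms with \<open>f t < w\<close> are fewer than \<open>B\<close> and at most
  \<open>B ^ (w - 1)\<close> each, so dividing by \<open>B ^ w\<close> removes them. Every remaining
  power of \<open>B\<close> is 1 modulo \<open>B - 1\<close>, and the count is below this
  modulus.\<close>

lemma card_eq_weight_sum_div_mod:
  fixes f :: "'a \<Rightarrow> nat" and B :: nat
  assumes "finite T" "card T < B - 1" "2 < B"
  shows "card {t \<in> T. w \<le> f t} = (\<Sum>t\<in>T. B ^ f t) div B ^ w mod (B - 1)"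
proof -
  let ?L = "{t \<in> T. f t < w}" and ?H = "{t \<in> T. w \<le> f t}"
  have "(\<Sum>t\<in>T. B ^ f t) = (\<Sum>t\<in>?L. B ^ f t) + (\<Sum>t\<in>?H. B ^ f t)"
    using assms(1) by (subst sum.union_disjoint[symmetric]) (auto intro!: sum.cong)
  also have "(\<Sum>t\<in>?H. B ^ f t) = B ^ w * (\<Sum>t\<in>?H. B ^ (f t - w))"
    unfolding sum_distrib_left by (intro sum.cong) (auto simp flip: power_add)
  finally have split: "(\<Sum>t\<in>T. B ^ f t) = (\<Sum>t\<in>?L. B ^ f t) + B ^ w * (\<Sum>t\<in>?H. B ^ (f t - w))" .
  have "(\<Sum>t\<in>?L. B ^ f t) < B ^ w"
  proof (cases w)
    case (Suc v)
    have "(\<Sum>t\<in>?L. B ^ f t) \<le> (\<Sum>t\<in>?L. B ^ v)"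
      using Suc assms(3) by (intro sum_mono power_increasing) auto
    also have "\<dots> \<le> card T * B ^ v"
      using assms(1) by (auto intro!: card_mono)
    also have "\<dots> < B * B ^ v"
      using assms(2,3) by (intro mult_strict_right_mono) auto
    finally show ?thesis
      by (simp add: Suc)
  qed simp
  then have "(\<Sum>t\<in>T. B ^ f t) div B ^ w = (\<Sum>t\<in>?H. B ^ (f t - w))"
    using assms(3) by (simp add: split)
  moreover have "B ^ e mod (B - 1) = 1" for e
  proof -
    have "B mod (B - 1) = 1"
      using mod_add_self2[of 1 "B - 1"] assms(3) by simp
    then have "B ^ e mod (B - 1) = 1 ^ e mod (B - 1)"
      using power_mod[of B "B - 1" e] by simp
    then show ?thesis
      using assms(3) by simp
  qed
  then have "(\<Sum>t\<in>?H. B ^ (f t - w)) mod (B - 1) = card ?H mod (B - 1)"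
    by (subst mod_sum_eq[symmetric]) simp
  moreover have "card ?H \<le> card T"
    using assms(1) by (auto intro: card_mono)
  ultimately show ?thesis
    using assms(2) by simp
qed

text \<open>With \<open>\<beta>(z) = \<Sum>\<^sub>j b\<^sub>j z\<^sup>j\<^sup>+\<^sup>1\<close> the recurrence says that \<open>a\<close> is the sequence of coefficients of
  \<open>z \<beta>'(z) / (1 - \<beta>(z))\<close>. At \<open>z = 1 / Z\<close> for large \<open>Z\<close> these are digits in base \<open>Z\<close>.\<close>

lemma series_coefficient_div_mod:
  fixes a b :: "nat \<Rightarrow> nat"
  assumes rec: "\<And>N. N \<le> n \<Longrightarrow> a N = (\<Sum>j<m. if Suc j = N then N * b j else 0) +
      (\<Sum>j<m. if Suc j \<le> N then b j * a (N - Suc j) else 0)"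
    and m: "m \<le> n" and n: "0 < n"
    and bE: "\<And>j. j < m \<Longrightarrow> b j \<le> E" and aE: "\<And>i. i \<le> n \<Longrightarrow> a i \<le> E"
    and Z: "n * (n + 1) * E ^ 2 + n * E < Z"
  shows "(\<Sum>j<m. Suc j * b j * Z ^ (n - Suc j)) * Z ^ n div
      (Z ^ n - (\<Sum>j<m. b j * Z ^ (n - Suc j))) mod Z = a n"
proof -
  \<comment> \<open>\<open>U\<close> and \<open>S\<close> are \<open>z \<beta>'(z)\<close> and
    \<open>\<beta>(z)\<close> at \<open>z = 1 / Z\<close>, scaled by \<open>Z ^ n\<close>;
    \<open>Q\<close> is the truncated series with the same scaling. The product \<open>S * Q\<close>
    splits into \<open>R'\<close>, the terms of degree at most \<open>n\<close> in \<open>z\<close>,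
    and the overflow \<open>R\<close>.\<close>
  define U where "U = (\<Sum>j<m. Suc j * b j * Z ^ (n - Suc j))"
  define S where "S = (\<Sum>j<m. b j * Z ^ (n - Suc j))"
  define Q where "Q = (\<Sum>i\<le>n. a i * Z ^ (n - i))"
  define R where "R = (\<Sum>j<m. \<Sum>i\<le>n. if i + Suc j \<le> n then 0 else b j * a i * (Z ^ (n - Suc j) * Z ^ (n - i)))"
  define R' where "R' = (\<Sum>j<m. \<Sum>i\<le>n. if i + Suc j \<le> n then b j * a i * (Z ^ (n - Suc j) * Z ^ (n - i)) else 0)"
  have "Z > 0"
    using Z by simp
  have SQ: "S * Q = R' + R"
    unfolding S_def Q_def R'_def R_def sum_product sum.distrib[symmetric]
    by (intro sum.cong refl) (simp add: algebra_simps)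
  have shift: "(\<Sum>N\<le>n. if Suc j \<le> N then b j * a (N - Suc j) * Z ^ (n - N) * Z ^ n else 0) =
      (\<Sum>i\<le>n. if i + Suc j \<le> n then b j * a i * (Z ^ (n - Suc j) * Z ^ (n - i)) else 0)"
    if "j < m" for j
  proof -
    have "(\<Sum>N\<in>{N \<in> {..n}. Suc j \<le> N}. b j * a (N - Suc j) * Z ^ (n - N) * Z ^ n) =
        (\<Sum>i\<in>{i \<in> {..n}. i + Suc j \<le> n}. b j * a i * (Z ^ (n - Suc j) * Z ^ (n - i)))"
    proof (rule sum.reindex_bij_witness[of _ "\<lambda>i. i + Suc j" "\<lambda>N. N - Suc j"])
      fix N assume "N \<in> {N \<in> {..n}. Suc j \<le> N}"
      then have "(n - Suc j) + (n - (N - Suc j)) = (n - N) + n"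
        by auto
      then show "b j * a (N - Suc j) * (Z ^ (n - Suc j) * Z ^ (n - (N - Suc j))) =
          b j * a (N - Suc j) * Z ^ (n - N) * Z ^ n"
        by (metis (no_types) mult.assoc power_add)
    qed auto
    then show ?thesis
      by (simp only: sum.inter_filter[OF finite_atMost])
  qed
  have "Q * Z ^ n = (\<Sum>N\<le>n. a N * Z ^ (n - N) * Z ^ n)"
    by (simp add: Q_def sum_distrib_right)
  also have "\<dots> = (\<Sum>N\<le>n. (\<Sum>j<m. if Suc j = N then N * b j * Z ^ (n - N) * Z ^ n else 0) +
      (\<Sum>j<m. if Suc j \<le> N then b j * a (N - Suc j) * Z ^ (n - N) * Z ^ n else 0))"
  proof (rule sum.cong)
    fix N assume "N \<in> {..n}"
    then have "a N * Z ^ (n - N) * Z ^ n = ((\<Sum>j<m. if Suc j = N then N * b j else 0) +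
      (\<Sum>j<m. if Suc j \<le> N then b j * a (N - Suc j) else 0)) * Z ^ (n - N) * Z ^ n"
      using rec[of N] by simp
    also have "\<dots> = (\<Sum>j<m. if Suc j = N then N * b j * Z ^ (n - N) * Z ^ n else 0) +
      (\<Sum>j<m. if Suc j \<le> N then b j * a (N - Suc j) * Z ^ (n - N) * Z ^ n else 0)"
      unfolding distrib_right sum_distrib_right by (intro arg_cong2[of _ _ _ _ "(+)"] sum.cong) auto
    finally show "a N * Z ^ (n - N) * Z ^ n = (\<Sum>j<m. if Suc j = N then N * b j * Z ^ (n - N) * Z ^ n else 0) +
      (\<Sum>j<m. if Suc j \<le> N then b j * a (N - Suc j) * Z ^ (n - N) * Z ^ n else 0)" .
  qed simp
  also have "\<dots> = (\<Sum>j<m. \<Sum>N\<le>n. if Suc j = N then N * b j * Z ^ (n - N) * Z ^ n else 0) +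
      (\<Sum>j<m. \<Sum>N\<le>n. if Suc j \<le> N then b j * a (N - Suc j) * Z ^ (n - N) * Z ^ n else 0)"
    unfolding sum.distrib by (intro arg_cong2[of _ _ _ _ "(+)"] sum.swap)
  also have "(\<Sum>j<m. \<Sum>N\<le>n. if Suc j = N then N * b j * Z ^ (n - N) * Z ^ n else 0) = U * Z ^ n"
    unfolding U_def sum_distrib_right
  proof (rule sum.cong)
    fix j assume "j \<in> {..<m}"
    then have "Suc j \<in> {..n}"
      using m by simp
    then show "(\<Sum>N\<le>n. if Suc j = N then N * b j * Z ^ (n - N) * Z ^ n else 0) =
        Suc j * b j * Z ^ (n - Suc j) * Z ^ n"
      by (subst sum.delta') auto
  qed simp
  also have "(\<Sum>j<m. \<Sum>N\<le>n. if Suc j \<le> N then b j * a (N - Suc j) * Z ^ (n - N) * Z ^ n else 0) = R'"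
    unfolding R'_def by (intro sum.cong shift) auto
  finally have QZ: "Q * Z ^ n = U * Z ^ n + R'" .
  have "S \<le> (\<Sum>j<m. E * Z ^ (n - 1))"
    unfolding S_def using bE \<open>Z > 0\<close> by (intro sum_mono mult_mono power_increasing) auto
  also have "\<dots> \<le> n * E * Z ^ (n - 1)"
    using m by simp
  finally have S: "S \<le> n * E * Z ^ (n - 1)" .
  have "R \<le> (\<Sum>j<m. \<Sum>i\<le>n. E ^ 2 * Z ^ (n - 1))"
    unfolding R_def
  proof (intro sum_mono)
    fix j i assume ji: "j \<in> {..<m}" "i \<in> {..n}"
    have "b j * a i * (Z ^ (n - Suc j) * Z ^ (n - i)) \<le> E ^ 2 * Z ^ (n - 1)" if "\<not> i + Suc j \<le> n"
    proof -
      have "b j * a i \<le> E ^ 2"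
        using ji bE aE by (auto simp: power2_eq_square intro!: mult_mono)
      moreover have "Z ^ (n - Suc j) * Z ^ (n - i) \<le> Z ^ (n - 1)"
        unfolding power_add[symmetric] using that ji m \<open>Z > 0\<close> by (intro power_increasing) auto
      ultimately show ?thesis
        by (rule mult_mono) auto
    qed
    then show "(if i + Suc j \<le> n then 0 else b j * a i * (Z ^ (n - Suc j) * Z ^ (n - i))) \<le> E ^ 2 * Z ^ (n - 1)"
      by simp
  qed
  also have "\<dots> = m * (n + 1) * E ^ 2 * Z ^ (n - 1)"
    by (simp add: algebra_simps)
  also have "\<dots> \<le> n * (n + 1) * E ^ 2 * Z ^ (n - 1)"
    using m by (intro mult_right_mono) auto
  \<comment> \<open>In each overflow term the exponent of \<open>Z\<close> is at most
    \<open>n - 1\<close>. So \<open>R\<close> will lie below the divisor \<open>Z ^ n - S\<close>,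
    which makes it the remainder and \<open>Q\<close> the quotient.\<close>
  finally have "R + S \<le> (n * (n + 1) * E ^ 2 + n * E) * Z ^ (n - 1)"
    using S by (simp add: algebra_simps)
  also have "\<dots> < Z * Z ^ (n - 1)"
    using Z \<open>Z > 0\<close> by (intro mult_strict_right_mono) auto
  also have "\<dots> = Z ^ n"
    using n by (cases n) auto
  finally have RS: "R + S < Z ^ n" .
  have "U * Z ^ n + S * Q = Z ^ n * Q + R"
    using SQ QZ by (simp add: mult.commute)
  then have "U * Z ^ n = (Z ^ n - S) * Q + R"
    using RS by (simp add: diff_mult_distrib)
  moreover have "R < Z ^ n - S"
    using RS by simp
  ultimately have "U * Z ^ n div (Z ^ n - S) = Q"
    by simp
  moreover have "Q mod Z = a n"
  proof -
    have "{..n} = insert n {..<n}"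
      by auto
    then have "Q = a n + (\<Sum>i<n. a i * Z ^ (n - i))"
      by (simp add: Q_def)
    moreover have "Z dvd (\<Sum>i<n. a i * Z ^ (n - i))"
      by (intro dvd_sum dvd_mult dvd_power) auto
    moreover have "a n < Z"
    proof -
      have "E \<le> n * E"
        using n by simp
      then show ?thesis
        using Z aE[of n] by linarith
    qed
    ultimately show ?thesis
      by (auto simp: dvd_def)
  qed
  ultimately show ?thesis
    by (simp add: U_def S_def)
qed

section \<open>Counting strings whose rotations all exceed a prefix\<close>

definition count_gt :: "nat \<Rightarrow> nat \<Rightarrow> nat \<Rightarrow> nat list \<Rightarrow> nat" where
  "count_gt k n w q =
     card {t \<in> strings_ge k n w. \<forall>i. q < take (length q) (rotate i t)}"

lemma sum_list_le_mult_length: "set t \<subseteq> {..k} \<Longrightarrow> sum_list t \<le> k * length (t :: nat list)"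
  by (induction t) auto

lemma strings_eq: "strings k n = {t. set t \<subseteq> {1..k} \<and> length t = n}"
  by (auto simp: strings_def)

lemma finite_strings: "finite (strings k n)"
  unfolding strings_eq by (rule finite_lists_length_eq) simp

lemma card_strings: "card (strings k n) = k ^ n"
  unfolding strings_eq by (subst card_lists_length_eq) auto

lemma list_less_take_iff:
  fixes q y :: "nat list"
  assumes "length q \<le> length y"
  shows "q < take (length q) y \<longleftrightarrow> (\<exists>j<length q. take j y = take j q \<and> q ! j < y ! j)"
  using assms unfolding list_less_def lexord_take_index_conv by (auto simp: eq_commute)

text \<open>For strings over \<open>1..k\<close>, being \<open>cyclic\<close> for
  \<open>blocks k q\<close> means that every rotation exceeds \<open>q\<close>, by looking at the
  first mismatch. What remains is to check that \<open>B\<close> and \<open>Z\<close> are large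
  enough for both extractions.\<close>

lemma count_gt_arith:
  fixes B Z :: nat
  assumes k: "1 \<le> k" and n: "1 \<le> n" and pre: "prenecklace q" and q: "set q \<subseteq> {1..k}" "length q \<le> n"
    and B: "B = (k + 2) ^ n" and Bn: "k ^ n < B - 1" "n + 1 \<le> B" and Z: "Z = B ^ (2 * k * n + 5)"
  shows "count_gt k n w q =
     (\<Sum>j<length q. Suc j * block_weight k B q j * Z ^ (n - Suc j)) * Z ^ n div
      (Z ^ n - (\<Sum>j<length q. block_weight k B q j * Z ^ (n - Suc j))) mod Z div B ^ w mod (B - 1)"
proof -
  have B3: "3 \<le> B"
    using Bn k one_le_power[of k n] by linarith
  have qk: "set q \<subseteq> {..k}"
    using q by auto
  interpret suffix_code "blocks k q"
    using suffix_code_blocks[OF pre qk] .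
  interpret weighted_code "blocks k q" B
    by unfold_locales (simp add: blocks_def)
  define b where "b = block_weight k B q"
  \<comment> \<open>Block weights, and coefficients up to index \<open>n\<close>, are sums of at
    most \<open>B\<close> powers of \<open>B\<close> with exponents at most
    \<open>k * n\<close>.\<close>
  define E where "E = B ^ (k * n + 1)"
  have letters: "\<Union> (set ` blocks k q) \<subseteq> {1..k}"
    using q by (fastforce simp: blocks_def dest: in_set_takeD)
  have cyc_strings: "{t. length t = i \<and> cyclic t} \<subseteq> strings k i" if "i > 0" for i
    using cyclic_letters letters that by (fastforce simp: strings_def)
  have "b j \<le> E" if "j < length q" for j
  proof -
    have "sum_list (take j q) \<le> k * j"
      using sum_list_le_mult_length[of "take j q" k] set_take_subset[of j q] qk that by auto
    moreover have "k * j + k \<le> k * n"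
      using that q(2) by (metis Suc_leI add.commute le_trans mult_Suc_right mult_le_mono2)
    ultimately have "b j \<le> (\<Sum>a\<in>{q ! j<..k}. B ^ (k * n))"
      unfolding b_def block_weight_def using B3 by (intro sum_mono power_increasing) auto
    also have "\<dots> \<le> k * B ^ (k * n)"
      by simp
    also have "\<dots> \<le> B * B ^ (k * n)"
    proof (rule mult_right_mono)
      have "k \<le> k ^ n"
        using k n by (cases n) auto
      then show "k \<le> B"
        using Bn by linarith
    qed simp
    finally show ?thesis
      by (simp add: E_def)
  qed
  moreover have "pointed_weight i \<le> E" if "i \<le> n" for i
  proof (cases "i = 0")
    case False
    have "pointed_weight i = (\<Sum>t\<in>{t. length t = i \<and> cyclic t}. B ^ sum_list t)"
      using pointed_weight_eq False by simp
    also have "\<dots> \<le> (\<Sum>t\<in>strings k i. B ^ sum_list t)"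
      using cyc_strings[of i] False finite_strings by (intro sum_mono2) auto
    also have "\<dots> \<le> (\<Sum>t\<in>strings k i. B ^ (k * n))"
    proof (intro sum_mono power_increasing)
      fix t assume "t \<in> strings k i"
      then have "set t \<subseteq> {..k}" "length t = i"
        by (auto simp: strings_def)
      then have "sum_list t \<le> k * i"
        using sum_list_le_mult_length by blast
      then show "sum_list t \<le> k * n"
        using that by (meson le_trans mult_le_mono2)
    qed (use B3 in simp)
    also have "\<dots> = k ^ i * B ^ (k * n)"
      by (simp add: card_strings)
    also have "\<dots> \<le> B * B ^ (k * n)"
    proof (rule mult_right_mono)
      have "k ^ i \<le> k ^ n"
        using k that by (intro power_increasing) auto
      then show "k ^ i \<le> B"
        using Bn by linarith
    qed simp
    finally show ?thesis
      by (simp add: E_def)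
  qed simp
  \<comment> \<open>Origin of the exponent in \<open>Z\<close>: the left side is below
    \<open>(n + 1) * (n + 1) * E ^ 2\<close>, which is at most
    \<open>B ^ 2 * B ^ (2 * k * n + 2)\<close>.\<close>
  moreover have "n * (n + 1) * E ^ 2 + n * E < Z"
  proof -
    have "1 \<le> E"
      using B3 by (simp add: E_def)
    have "n * (n + 1) * E ^ 2 + n * E \<le> n * (n + 1) * E ^ 2 + n * E ^ 2"
      using \<open>1 \<le> E\<close> by (simp add: power2_eq_square)
    also have "\<dots> = n * (n + 2) * E ^ 2"
      by (simp add: algebra_simps)
    also have "\<dots> < (n + 1) * (n + 1) * E ^ 2"
      using \<open>1 \<le> E\<close> by (intro mult_strict_right_mono) auto
    also have "\<dots> \<le> B * B * E ^ 2"
      using Bn by (intro mult_right_mono mult_mono) auto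
    also have "\<dots> = B ^ (2 * k * n + 4)"
      by (simp add: E_def power_add power2_eq_square mult.assoc flip: power_mult) (simp add: mult_2 algebra_simps power_add eval_nat_numeral)
    also have "\<dots> \<le> Z"
      unfolding Z using B3 by (intro power_increasing) auto
    finally show ?thesis .
  qed
  moreover have "pointed_weight N = (\<Sum>j<length q. if Suc j = N then N * b j else 0) +
      (\<Sum>j<length q. if Suc j \<le> N then b j * pointed_weight (N - Suc j) else 0)" for N
    unfolding pointed_weight_rec[of N] sum_blocks b_def block_weight_def
    using q(2)
    by (intro arg_cong2[of _ _ _ _ "(+)"] sum.cong)
      (auto simp: sum_distrib_left sum_distrib_right min_def)
  ultimately have "(\<Sum>j<length q. Suc j * b j * Z ^ (n - Suc j)) * Z ^ n div
      (Z ^ n - (\<Sum>j<length q. b j * Z ^ (n - Suc j))) mod Z = pointed_weight n"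
    using q n by (intro series_coefficient_div_mod[where E = E]) auto
  moreover have "pointed_weight n div B ^ w mod (B - 1) =
      card {t \<in> {t. length t = n \<and> cyclic t}. w \<le> sum_list t}"
  proof -
    have fin: "finite {t. length t = n \<and> cyclic t}"
      using finite_subset[OF cyc_strings finite_strings] n by simp
    have "card {t. length t = n \<and> cyclic t} \<le> k ^ n"
      using card_mono[OF finite_strings cyc_strings[of n]] n by (simp add: card_strings)
    then show ?thesis
      using card_eq_weight_sum_div_mod[OF fin, of B w sum_list] Bn B3 n pointed_weight_eq by simp
  qed
  moreover have "{t \<in> {t. length t = n \<and> cyclic t}. w \<le> sum_list t} =
      {t \<in> strings_ge k n w. \<forall>i. q < take (length q) (rotate i t)}"
  proof -
    have "cyclic t \<longleftrightarrow> (\<forall>i. q < take (length q) (rotate i t))" if "t \<in> strings k n" for t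
    proof -
      have "rotate i t ! j \<le> k" if "j < n" for i j
        using \<open>t \<in> strings k n\<close> that nth_mem[of j "rotate i t"] by (auto simp: strings_def)
      moreover have len: "length (rotate i t) = n" for i
        using that by (simp add: strings_def)
      ultimately have "(\<exists>z\<in>blocks k q. \<exists>y'. rotate i t = z @ y') \<longleftrightarrow> q < take (length q) (rotate i t)" for i
        using q(2) unfolding begins_with_block_iff list_less_take_iff[OF q(2)[folded len[of i]]] len
        by (meson less_le_trans)
      then show ?thesis
        by (simp add: cyclic_def begins_def)
    qed
    then show ?thesis
      using cyc_strings[of n] n by (auto simp: strings_ge_def strings_def weight_def)
  qed
  ultimately show ?thesis
    by (simp add: count_gt_def b_def)
qed

section \<open>Necklaces and positions in the universal cycle\<close>

definition minrot :: "nat list \<Rightarrow> nat list" where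
  "minrot t = Min (range (\<lambda>i. rotate i t))"

lemma rotate_inverse: "\<exists>j. rotate j (rotate i t) = t"
proof (cases "t = []")
  case False
  let ?n = "length t"
  have "i mod ?n < ?n"
    using False by simp
  then have "rotate (?n - i mod ?n) (rotate (i mod ?n) t) = t"
    unfolding rotate_rotate by simp
  then show ?thesis
    using rotate_conv_mod[of i t] by metis
qed simp

lemma range_rotate_eq: "range (\<lambda>j. rotate j (rotate i t)) = range (\<lambda>j. rotate j t)"
proof (intro equalityI subsetI)
  fix y assume "y \<in> range (\<lambda>j. rotate j t)"
  then obtain j where "y = rotate j t"
    by blast
  moreover obtain i' where "rotate i' (rotate i t) = t"
    using rotate_inverse by blast
  ultimately have "y = rotate (j + i') (rotate i t)"
    by (metis rotate_rotate)
  then show "y \<in> range (\<lambda>j. rotate j (rotate i t))"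
    by blast
qed (auto simp: rotate_rotate)

lemma finite_rotations: "finite (range (\<lambda>i. rotate i t))"
proof (cases "t = []")
  case False
  then have "range (\<lambda>i. rotate i t) = (\<lambda>i. rotate i t) ` {..<length t}"
    using rotate_conv_mod[of _ t] by (auto intro!: image_eqI[where x = "_ mod length t"])
  then show ?thesis
    by simp
qed simp

lemma minrot_le: "minrot t \<le> rotate i t"
  unfolding minrot_def by (rule Min_le[OF finite_rotations]) simp

lemma minrot_rotation: "\<exists>i. minrot t = rotate i t"
proof -
  have "minrot t \<in> range (\<lambda>i. rotate i t)"
    unfolding minrot_def by (rule Min_in[OF finite_rotations]) simp
  then show ?thesis
    by blast
qed

lemma minrot_rotate: "minrot (rotate i t) = minrot t"
  by (simp only: minrot_def range_rotate_eq)

lemma necklace_iff_minrot: "necklace s \<longleftrightarrow> minrot s = s"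
proof
  assume "necklace s"
  then show "minrot s = s"
    using minrot_rotation[of s] minrot_le[of s 0] by (metis antisym necklace_def rotate0 id_apply)
next
  assume "minrot s = s"
  then show "necklace s"
    using minrot_le[of s] by (simp add: necklace_def)
qed

lemma necklace_minrot: "necklace (minrot t)"
  unfolding necklace_iff_minrot using minrot_rotation[of t] minrot_rotate[of _ t] by metis

lemma minrot_eq_iff:
  assumes "necklace s"
  shows "minrot t = s \<longleftrightarrow> t \<in> range (\<lambda>i. rotate i s)"
proof
  assume "minrot t = s"
  then show "t \<in> range (\<lambda>i. rotate i s)"
    using minrot_rotation[of t] rotate_inverse[of _ t] by (metis rangeI)
next
  assume "t \<in> range (\<lambda>i. rotate i s)"
  then show "minrot t = s"
    using assms necklace_iff_minrot minrot_rotate by auto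
qed

lemma rotate_in_strings_ge: "t \<in> strings_ge k n w \<Longrightarrow> rotate i t \<in> strings_ge k n w"
  by (simp add: strings_ge_def strings_def weight_def sum_list_rotate)

section \<open>Primitive roots and the sizes of rotation classes\<close>

lemma ap_power: "\<exists>j\<ge>1. s = concat (replicate j (ap s))"
  unfolding ap_def by (rule arg_min_natI[where k = s]) (auto intro!: exI[of _ 1])

lemma length_ap_le: "s = concat (replicate j t) \<Longrightarrow> 1 \<le> j \<Longrightarrow> length (ap s) \<le> length t"
  unfolding ap_def by (rule arg_min_nat_le) blast

lemma ap_suffix: "\<exists>r. s = r @ ap s \<and> rotate (length (ap s)) s = s"
proof -
  obtain j where j: "j \<ge> 1" "s = concat (replicate j (ap s))"
    using ap_power by blast
  then obtain i where i: "j = Suc i"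
    by (cases j) auto
  define r where "r = concat (replicate i (ap s))"
  have "s = ap s @ r"
    using j(2) by (simp add: i r_def)
  moreover have "s = r @ ap s"
    using j(2) by (simp add: i r_def replicate_append_same[symmetric] del: replicate_append_same)
  ultimately show ?thesis
    using rotate_append[of "ap s" r] by metis
qed

text \<open>A rotation by \<open>p\<close> fixing \<open>s\<close> makes \<open>take p s\<close> and
  \<open>drop p s\<close> commute, so both are powers of one word, a root of \<open>s\<close> no
  longer than \<open>p\<close>.\<close>

lemma rotate_fixed_root:
  assumes "rotate p s = s" "0 < p" "p < length s"
  shows "length (ap s) \<le> p"
proof -
  have "drop p s @ take p s = s"
    using assms by (simp add: rotate_drop_take)
  then have "take p s @ drop p s = drop p s @ take p s"
    by simp
  then obtain i j zs where zs: "concat (replicate i zs) = take p s" "concat (replicate j zs) = drop p s"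
    using comm_append_are_replicate by blast
  then have "s = concat (replicate (i + j) zs)"
    by (simp add: replicate_add)
  moreover have "i \<noteq> 0"
    using zs(1) assms by (intro notI) auto
  ultimately have "length (ap s) \<le> length zs"
    by (intro length_ap_le) auto
  also have "\<dots> \<le> length (concat (replicate i zs))"
    using \<open>i \<noteq> 0\<close> by (cases i) auto
  also have "\<dots> = p"
    using zs(1) assms by simp
  finally show ?thesis .
qed

text \<open>Rotations depend only on the offset modulo \<open>length (ap s)\<close>; if two smaller
  offsets agreed, their difference would fix \<open>s\<close>, against
  \<open>rotate_fixed_root\<close>.\<close>

lemma card_rotations:
  assumes "s \<noteq> []"
  shows "card (range (\<lambda>i. rotate i s)) = length (ap s)"
proof -
  let ?p = "length (ap s)"
  have fixed: "rotate ?p s = s"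
    using ap_suffix by blast
  have "ap s \<noteq> []"
  proof
    assume "ap s = []"
    then show False
      using ap_power[of s] assms by simp
  qed
  have mult: "rotate (q * ?p) s = s" for q
    using fixed by (induction q) (simp_all add: rotate_rotate[symmetric])
  have "range (\<lambda>i. rotate i s) = (\<lambda>i. rotate i s) ` {..<?p}"
  proof -
    have "rotate i s = rotate (i mod ?p) s" for i
      using mult[of "i div ?p"] rotate_rotate[of "i mod ?p" "i div ?p * ?p" s] by simp
    moreover have "i mod ?p < ?p" for i
      using \<open>ap s \<noteq> []\<close> by simp
    ultimately show ?thesis
      by (auto intro: image_eqI[where x = "_ mod ?p"])
  qed
  moreover have "inj_on (\<lambda>i. rotate i s) {..<?p}"
  proof (rule linorder_inj_onI, goal_cases)
    case (1 i j)
    show ?case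
    proof
      assume eq: "rotate i s = rotate j s"
      obtain i' where i': "rotate i' (rotate i s) = s"
        using rotate_inverse by blast
      have "rotate (j - i) s = rotate (i' + i) (rotate (j - i) s)"
        using i' by (metis add.commute rotate_rotate)
      also have "\<dots> = rotate i' (rotate j s)"
        using 1 by (simp add: rotate_rotate)
      also have "\<dots> = s"
        using eq i' by simp
      finally have "rotate (j - i) s = s" .
      moreover have "?p \<le> length s"
        using ap_suffix[of s] by (metis le_add2 length_append)
      ultimately have "?p \<le> j - i"
        using 1 by (intro rotate_fixed_root) auto
      then show False
        using 1 by auto
    qed
  qed auto
  ultimately show ?thesis
    by (simp add: card_image)
qed

lemma finite_strings_ge: "finite (strings_ge k n w)"
  using finite_strings by (simp add: strings_ge_def)

text \<open>Grouping strings by minimal rotation turns numbers of strings into lengths of stretches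
  of the universal cycle.\<close>

lemma card_by_minrot:
  assumes "0 < n"
  shows "card {t \<in> strings_ge k n w. P (minrot t)} =
    (\<Sum>s\<in>{s \<in> strings_ge k n w. necklace s \<and> P s}. length (ap s))"
proof -
  let ?T = "{t \<in> strings_ge k n w. P (minrot t)}"
  let ?N = "{s \<in> strings_ge k n w. necklace s \<and> P s}"
  have "minrot ` ?T \<subseteq> ?N"
    using minrot_rotation necklace_minrot rotate_in_strings_ge by (auto, metis)
  then have "card ?T = (\<Sum>s\<in>?N. card {t \<in> ?T. minrot t = s})"
    using finite_strings_ge sum.group[of ?T ?N minrot "\<lambda>_. 1::nat"] by simp
  also have "\<dots> = (\<Sum>s\<in>?N. length (ap s))"
  proof (rule sum.cong)
    fix s assume s: "s \<in> ?N"
    then have "{t \<in> ?T. minrot t = s} = {t \<in> strings_ge k n w. minrot t = s}"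
      by auto
    also have "\<dots> = range (\<lambda>i. rotate i s)"
      using s minrot_eq_iff[of s] rotate_in_strings_ge by auto
    finally have "{t \<in> ?T. minrot t = s} = range (\<lambda>i. rotate i s)" .
    moreover have "s \<noteq> []"
      using s assms by (auto simp: strings_ge_def strings_def)
    ultimately show "card {t \<in> ?T. minrot t = s} = length (ap s)"
      using card_rotations by simp
  qed simp
  finally show ?thesis .
qed

lemma set_necklace_list: "set (necklace_list k n w) = {s \<in> strings_ge k n w. necklace s}"
  unfolding necklace_list_def using finite_strings_ge by simp

lemma length_ucycle:
  assumes "0 < n"
  shows "length (ucycle k n w) = card (strings_ge k n w)"
proof -
  have "length (ucycle k n w) = (\<Sum>s\<in>set (necklace_list k n w). length (ap s))"
    by (simp add: ucycle_def length_concat comp_def sum_list_distinct_conv_sum_set necklace_list_def)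
  then show ?thesis
    using card_by_minrot[OF assms, of k w "\<lambda>_. True"] by (simp add: set_necklace_list)
qed

text \<open>The part of the cycle after \<open>ap s\<close> has length \<open>?c\<close>, so the
  position at distance \<open>r\<close> from the end falls into \<open>ap s\<close>. As
  \<open>ap s\<close> is a suffix of \<open>s\<close>, the symbol can be read from \<open>s\<close>
  without determining \<open>ap s\<close>.\<close>

lemma ucycle_nth:
  assumes "0 < n" and s: "s \<in> strings_ge k n w" "necklace s"
    and lo: "card {t \<in> strings_ge k n w. s < minrot t} < r"
    and hi: "r \<le> card {t \<in> strings_ge k n w. s \<le> minrot t}"
  shows "r \<le> n + card {t \<in> strings_ge k n w. s < minrot t}"
    and "ucycle k n w ! (length (ucycle k n w) - r) =
      s ! (n + card {t \<in> strings_ge k n w. s < minrot t} - r)"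
proof -
  let ?N = "{s \<in> strings_ge k n w. necklace s}"
  let ?c = "card {t \<in> strings_ge k n w. s < minrot t}"
  have "s \<in> set (necklace_list k n w)"
    using s by (simp add: set_necklace_list)
  then obtain ys zs where split: "necklace_list k n w = ys @ s # zs"
    by (meson split_list)
  have ssorted: "sorted_wrt (<) (ys @ s # zs)"
    unfolding split[symmetric] necklace_list_def by simp
  have "set zs = {z \<in> strings_ge k n w. necklace z \<and> s < z}"
  proof -
    have "set (ys @ s # zs) = ?N"
      using set_necklace_list split by metis
    then show ?thesis
      using ssorted by (auto simp: sorted_wrt_append dest: order.asym)
  qed
  moreover have "distinct zs"
    using ssorted strict_sorted_iff[of "ys @ s # zs"] by simp
  ultimately have zs: "length (concat (map ap zs)) = ?c"
    using card_by_minrot[OF assms(1), of k w "\<lambda>z. s < z"]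
    by (simp add: length_concat comp_def sum_list_distinct_conv_sum_set)
  have "{t \<in> strings_ge k n w. s \<le> minrot t} =
      {t \<in> strings_ge k n w. s < minrot t} \<union> {t \<in> strings_ge k n w. minrot t = s}"
    by auto
  then have "card {t \<in> strings_ge k n w. s \<le> minrot t} = ?c + card {t \<in> strings_ge k n w. minrot t = s}"
    using finite_strings_ge[of k n w] by (simp, subst card_Un_disjoint) auto
  moreover have "{t \<in> strings_ge k n w. minrot t = s} = range (\<lambda>i. rotate i s)"
    using minrot_eq_iff[of s] s rotate_in_strings_ge by auto
  moreover have len: "length s = n"
    using s by (simp add: strings_ge_def strings_def)
  ultimately have r: "r \<le> ?c + length (ap s)"
    using hi card_rotations[of s] assms(1) by auto
  define e where "e = r - ?c"
  have e: "0 < e" "e \<le> length (ap s)" "r = ?c + e"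
    using lo r by (auto simp: e_def)
  have "ucycle k n w = concat (map ap ys) @ ap s @ concat (map ap zs)"
    by (simp add: ucycle_def split)
  then have "ucycle k n w ! (length (ucycle k n w) - r) = ap s ! (length (ap s) - e)"
  proof -
    have "length (ucycle k n w) - r = length (concat (map ap ys)) + (length (ap s) - e)"
      using e zs by (simp add: \<open>ucycle k n w = _\<close>)
    moreover have "length (ap s) - e < length (ap s)"
      using e by simp
    ultimately show ?thesis
      by (simp only: \<open>ucycle k n w = _\<close> nth_append_length_plus) (simp only: nth_append if_True)
  qed
  moreover obtain x where x: "s = x @ ap s"
    using ap_suffix by blast
  moreover from this have "length (ap s) \<le> n"
    using len by (metis le_add2 length_append)
  moreover have "s ! (n - e) = ap s ! (length (ap s) - e)"
    using e(1,2) len arg_cong[OF x, of length] by (subst x) (auto simp: nth_append intro!: arg_cong[of _ _ "(!) (ap s)"])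
  ultimately show "r \<le> n + ?c" "ucycle k n w ! (length (ucycle k n w) - r) = s ! (n + ?c - r)"
    using e by simp_all
qed

section \<open>Locating a necklace digit by digit\<close>

text \<open>The bound \<open>max 1 (length q)\<close> gives the empty list period 1 and always
  admits the full length as a period.\<close>

definition least_period :: "nat list \<Rightarrow> nat \<Rightarrow> bool" where
  "least_period q p \<longleftrightarrow> 1 \<le> p \<and> p \<le> max 1 (length q) \<and>
     (\<forall>i. p + i < length q \<longrightarrow> q ! (p + i) = q ! i) \<and>
     (\<forall>b. 1 \<le> b \<and> b < p \<longrightarrow> (\<exists>i. b + i < length q \<and> q ! (b + i) \<noteq> q ! i))"

text \<open>The letter that continues the least period, which is the least letter by which a
  prenecklace can be extended.\<close>

definition min_next :: "nat list \<Rightarrow> nat \<Rightarrow> nat" where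
  "min_next q p = (if q = [] then 1 else q ! (length q - p))"

text \<open>Each border of \<open>q\<close> demands that the next letter be at least the one
  following the border. The longest border makes the strongest demand: the shorter one recurs inside
  it at shift \<open>b - p\<close>, where \<open>prenecklace\<close> compares the two following
  letters.\<close>

lemma border_le_min_next:
  assumes "prenecklace q" "least_period q p" "1 \<le> b" "b \<le> length q"
    and border: "\<And>i. b + i < length q \<Longrightarrow> q ! (b + i) = q ! i"
  shows "q ! (length q - b) \<le> min_next q p"
proof -
  let ?m = "length q"
  have "p \<le> b"
    using assms unfolding least_period_def by (meson not_less)
  have per: "q ! (p + i) = q ! i" if "p + i < ?m" for i
    using assms(2) that by (simp add: least_period_def)
  have p: "1 \<le> p" "p \<le> ?m"
    using assms \<open>p \<le> b\<close> by (auto simp: least_period_def)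
  have "q ! (b - p + i) = q ! i" if "i < ?m - b" for i
    using per[of "b - p + i"] border[of i] that \<open>p \<le> b\<close> by simp
  moreover have "b - p + (?m - b) = ?m - p" "?m - p < ?m"
    using p \<open>p \<le> b\<close> assms(4) by auto
  ultimately have "q ! (?m - b) \<le> q ! (?m - p)"
    using assms(1) unfolding prenecklace_def by metis
  then show ?thesis
    using p by (auto simp: min_next_def)
qed

lemma prenecklace_snoc:
  assumes "prenecklace q" "least_period q p" "min_next q p \<le> d"
  shows "prenecklace (q @ [d])"
  unfolding prenecklace_def
proof (intro allI impI)
  fix b j
  assume bj: "b + j < length (q @ [d])" and eq: "\<forall>i<j. (q @ [d]) ! (b + i) = (q @ [d]) ! i"
  show "(q @ [d]) ! j \<le> (q @ [d]) ! (b + j)"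
  proof (cases "b = 0 \<or> b + j < length q")
    case True
    moreover have "(q @ [d]) ! (b + i) = q ! (b + i)" "(q @ [d]) ! i = q ! i" if "b + i < length q" for i
      using that by (simp_all add: nth_append)
    ultimately show ?thesis
      using assms(1) eq unfolding prenecklace_def
      by (smt (verit, best) add_0 add_less_cancel_left less_trans order_refl)
  next
    case False
    then have b: "1 \<le> b" "b + j = length q"
      using bj by auto
    have "q ! (b + i) = q ! i" if "b + i < length q" for i
      using eq[rule_format, of i] that b by (auto simp: nth_append split: if_splits)
    then have "q ! (length q - b) \<le> min_next q p"
      using assms b by (intro border_le_min_next) auto
    moreover have "length q - b = j"
      using b by simp
    ultimately show ?thesis
      using b assms(3) by (simp add: nth_append)
  qed
qed

text \<open>A letter equal to \<open>min_next q p\<close> continues the period, whereas a larger one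
  breaks every border and leaves only the full length.\<close>

lemma least_period_snoc:
  assumes "prenecklace q" "least_period q p" "min_next q p \<le> d"
  shows "least_period (q @ [d]) (if min_next q p < d then Suc (length q) else p)"
proof (cases "min_next q p < d")
  case False
  then have d: "d = min_next q p"
    using assms(3) by simp
  have "(q @ [d]) ! (p + i) = (q @ [d]) ! i" if "p + i < length (q @ [d])" for i
  proof (cases "p + i < length q")
    case True
    then show ?thesis
      using assms(2) by (simp add: least_period_def nth_append)
  next
    case False
    then have i: "p + i = length q"
      using that by simp
    moreover from this have "length q - p = i" "q \<noteq> []" "i < length q"
      using assms(2) by (auto simp: least_period_def)
    ultimately show ?thesis
      by (simp add: nth_append d min_next_def)
  qed
  moreover have "\<exists>i. b + i < length (q @ [d]) \<and> (q @ [d]) ! (b + i) \<noteq> (q @ [d]) ! i"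
    if b: "1 \<le> b" "b < p" for b
  proof -
    obtain i where "b + i < length q" "q ! (b + i) \<noteq> q ! i"
      using assms(2) b unfolding least_period_def by blast
    then show ?thesis
      by (intro exI[of _ i]) (simp add: nth_append)
  qed
  ultimately show ?thesis
    using assms(2) False unfolding least_period_def by auto
next
  case True
  have "\<exists>i. b + i < length (q @ [d]) \<and> (q @ [d]) ! (b + i) \<noteq> (q @ [d]) ! i"
    if b: "1 \<le> b" "b \<le> length q" for b
  proof (rule ccontr)
    assume "\<not> ?thesis"
    then have eq: "(q @ [d]) ! (b + i) = (q @ [d]) ! i" if "b + i \<le> length q" for i
      using that by auto
    have "q ! (b + i) = q ! i" if "b + i < length q" for i
      using eq[of i] that by (simp add: nth_append)
    then have "q ! (length q - b) \<le> min_next q p"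
      using assms b by (intro border_le_min_next) auto
    moreover have "d = q ! (length q - b)"
      using eq[of "length q - b"] b by (simp add: nth_append split: if_splits)
    ultimately show False
      using True by simp
  qed
  then show ?thesis
    using True unfolding least_period_def by auto
qed

definition count_ge :: "nat \<Rightarrow> nat \<Rightarrow> nat \<Rightarrow> nat list \<Rightarrow> nat" where
  "count_ge k n w q =
     card {t \<in> strings_ge k n w. \<forall>i. q \<le> take (length q) (rotate i t)}"

text \<open>The search invariant: when strings are counted downwards by minimal rotation, number
  \<open>r\<close> is among those whose minimal rotation starts with \<open>q\<close>. The period
  \<open>p\<close> is carried along to find the least next digit.\<close>

definition located :: "nat \<Rightarrow> nat \<Rightarrow> nat \<Rightarrow> nat \<Rightarrow> nat list \<Rightarrow> nat \<Rightarrow> bool" where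
  "located k n w r q p \<longleftrightarrow> length q \<le> n \<and> set q \<subseteq> {1..k} \<and> prenecklace q \<and> least_period q p \<and>
     count_gt k n w q < r \<and> r \<le> count_ge k n w q"

lemma located_Nil:
  assumes "1 \<le> r" "r \<le> card (strings_ge k n w)"
  shows "located k n w r [] 1"
  using assms by (simp add: located_def prenecklace_def least_period_def count_gt_def count_ge_def)

lemma snoc_less_snoc:
  fixes q x :: "nat list"
  assumes "length q = length x"
  shows "q @ [d] < x @ [c] \<longleftrightarrow> q < x \<or> q = x \<and> d < c"
  using assms by (induction q x rule: list_induct2) auto

lemma list_le_nthD:
  fixes q y :: "nat list"
  assumes "q \<le> y" "length y = length q" "j < length q" "\<And>i. i < j \<Longrightarrow> y ! i = q ! i"
  shows "q ! j \<le> y ! j"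
proof (rule ccontr)
  assume "\<not> ?thesis"
  moreover have "take j q = take j y"
    using assms(2,3,4) by (intro nth_equalityI) auto
  ultimately have "y < take (length y) q"
    using assms(2,3) by (subst list_less_take_iff) auto
  then show False
    using assms(1,2) by simp
qed

lemma min_next_bounds:
  assumes "set q \<subseteq> {1..k}" "least_period q p" "1 \<le> k"
  shows "1 \<le> min_next q p" "min_next q p \<le> k"
proof -
  have "q ! (length q - p) \<in> {1..k}" if "q \<noteq> []"
    using that assms(1,2) by (intro subsetD[OF assms(1) nth_mem]) (auto simp: least_period_def)
  then show "1 \<le> min_next q p" "min_next q p \<le> k"
    using assms(3) by (auto simp: min_next_def)
qed

text \<open>No letter exceeds \<open>k\<close>, so a rotation beating \<open>q @ [k]\<close> already
  beats \<open>q\<close>. This stops the search for the next digit at \<open>k\<close> at the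
  latest.\<close>

lemma count_gt_snoc_max:
  assumes "length q < n"
  shows "count_gt k n w (q @ [k]) \<le> count_gt k n w q"
  unfolding count_gt_def
proof (intro card_mono subsetI)
  fix t assume t: "t \<in> {t \<in> strings_ge k n w. \<forall>i. q @ [k] < take (length (q @ [k])) (rotate i t)}"
  then have len: "length t = n" "set t \<subseteq> {..k}"
    by (auto simp: strings_ge_def strings_def)
  have "q < take (length q) (rotate i t)" for i
  proof -
    have "q @ [k] < take (length q) (rotate i t) @ [rotate i t ! length q]"
      using t len assms by (simp add: take_Suc_conv_app_nth)
    moreover have "rotate i t ! length q \<le> k"
      using len assms nth_mem[of "length q" "rotate i t"] by auto
    ultimately show ?thesis
      using len assms by (subst (asm) snoc_less_snoc) auto
  qed
  then show "t \<in> {t \<in> strings_ge k n w. \<forall>i. q < take (length q) (rotate i t)}"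
    using t by simp
qed (simp add: finite_strings_ge)

text \<open>If a rotation begins with \<open>q\<close>, rotating by \<open>p\<close> more exposes
  the longest border; the result is also at least \<open>q\<close>, so the letter after the border
  is at least \<open>min_next q p\<close>. Hence skipping smaller digits loses no string.\<close>

lemma count_ge_snoc_min_next:
  assumes "length q < n" "least_period q p"
  shows "count_ge k n w q \<le> count_ge k n w (q @ [min_next q p])"
  unfolding count_ge_def
proof (intro card_mono subsetI)
  fix t assume t: "t \<in> {t \<in> strings_ge k n w. \<forall>i. q \<le> take (length q) (rotate i t)}"
  then have len: "length t = n" "set t \<subseteq> {1..k}"
    by (auto simp: strings_ge_def strings_def)
  have "q @ [min_next q p] \<le> take (length q) (rotate i t) @ [rotate i t ! length q]" for i
  proof (cases "q = take (length q) (rotate i t)")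
    case False
    then have "q < take (length q) (rotate i t)"
      using t by (simp add: order.strict_iff_order)
    then have "q @ [min_next q p] < take (length q) (rotate i t) @ [rotate i t ! length q]"
      using len assms by (subst snoc_less_snoc) auto
    then show ?thesis
      by simp
  next
    case True
    have "min_next q p \<le> rotate i t ! length q"
    proof (cases "q = []")
      case True
      then show ?thesis
        using len assms(1) nth_mem[of 0 "rotate i t"] by (auto simp: min_next_def)
    next
      case False
      define y where "y = rotate p (rotate i t)"
      have p: "1 \<le> p" "p \<le> length q"
        using assms(2) False by (auto simp: least_period_def Suc_le_eq)
      have y: "y ! j = rotate i t ! (p + j)" if "p + j < n" for j
        using that len by (simp add: y_def nth_rotate[of _ "rotate i t"] add.commute)
      have "q \<le> take (length q) y"
        using t by (simp add: y_def rotate_rotate)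
      moreover have "take (length q) y ! j = q ! j" if "j < length q - p" for j
      proof -
        have "rotate i t ! (p + j) = q ! (p + j)"
          using that by (subst True) simp
        then show ?thesis
          using that y assms by (simp add: least_period_def)
      qed
      ultimately have "q ! (length q - p) \<le> take (length q) y ! (length q - p)"
        using p len assms(1) by (intro list_le_nthD) (auto simp: y_def)
      then show ?thesis
        using p y[of "length q - p"] assms(1) False by (simp add: min_next_def)
    qed
    then show ?thesis
      using True snoc_less_snoc[of q q "min_next q p" "rotate i t ! length q"] by (auto simp: le_less)
  qed
  then show "t \<in> {t \<in> strings_ge k n w. \<forall>i. q @ [min_next q p] \<le> take (length (q @ [min_next q p])) (rotate i t)}"
    using t len assms(1) by (simp add: take_Suc_conv_app_nth)
qed (simp add: finite_strings_ge)

text \<open>No letter lies strictly between \<open>d\<close> and \<open>Suc d\<close>. Thus a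
  rejected candidate supplies the upper bound for its successor.\<close>

lemma count_gt_le_count_ge_snoc:
  assumes "length q < n"
  shows "count_gt k n w (q @ [d]) \<le> count_ge k n w (q @ [Suc d])"
  unfolding count_gt_def count_ge_def
proof (intro card_mono subsetI)
  fix t assume t: "t \<in> {t \<in> strings_ge k n w. \<forall>i. q @ [d] < take (length (q @ [d])) (rotate i t)}"
  then have len: "length t = n"
    by (auto simp: strings_ge_def strings_def)
  have "q @ [Suc d] \<le> take (length q) (rotate i t) @ [rotate i t ! length q]" for i
  proof -
    have "q @ [d] < take (length q) (rotate i t) @ [rotate i t ! length q]"
      using t len assms by (simp add: take_Suc_conv_app_nth)
    then have "q < take (length q) (rotate i t) \<or>
        q = take (length q) (rotate i t) \<and> Suc d \<le> rotate i t ! length q"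
      using len assms by (subst (asm) snoc_less_snoc) auto
    then show ?thesis
      using len assms snoc_less_snoc[of q "take (length q) (rotate i t)" "Suc d" "rotate i t ! length q"]
      by (auto simp: le_less)
  qed
  then show "t \<in> {t \<in> strings_ge k n w. \<forall>i. q @ [Suc d] \<le> take (length (q @ [Suc d])) (rotate i t)}"
    using t len assms by (simp add: take_Suc_conv_app_nth)
qed (simp add: finite_strings_ge)

lemma located_snoc:
  assumes "located k n w r q p" "length q < n" "min_next q p \<le> d" "1 \<le> d" "d \<le> k"
    and "count_gt k n w (q @ [d]) < r"
    and "d = min_next q p \<or> r \<le> count_gt k n w (q @ [d - 1])"
  shows "located k n w r (q @ [d]) (if min_next q p < d then Suc (length q) else p)"
proof -
  have "r \<le> count_ge k n w (q @ [d])"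
    using assms(7)
  proof
    assume "d = min_next q p"
    then show ?thesis
      using assms count_ge_snoc_min_next[of q n p k w] unfolding located_def by auto
  next
    assume "r \<le> count_gt k n w (q @ [d - 1])"
    then show ?thesis
      using count_gt_le_count_ge_snoc[of q n k w "d - 1"] assms by simp
  qed
  then show ?thesis
    using assms(1-6) prenecklace_snoc[of q p d] least_period_snoc[of q p d] unfolding located_def by simp
qed

text \<open>The strict gap between the two counts yields a string with minimal rotation
  \<open>q\<close>, so a located list of full length is itself a necklace of the list.\<close>

lemma located_ucycle_nth:
  assumes "located k n w r q p" "length q = n" "0 < n"
  shows "r \<le> n + count_gt k n w q"
    and "ucycle k n w ! (card (strings_ge k n w) - r) = q ! (n + count_gt k n w q - r)"
proof -
  have len: "length t = n" if "t \<in> strings_ge k n w" for t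
    using that by (simp add: strings_ge_def strings_def)
  have "(\<forall>i. q < take n (rotate i t)) \<longleftrightarrow> q < minrot t" if "t \<in> strings_ge k n w" for t
    using len[OF that] minrot_rotation[of t] minrot_le[of t] by simp (metis less_le_trans)
  then have gt: "count_gt k n w q = card {t \<in> strings_ge k n w. q < minrot t}"
    using assms(2) by (simp add: count_gt_def cong: conj_cong)
  have "(\<forall>i. q \<le> take n (rotate i t)) \<longleftrightarrow> q \<le> minrot t" if "t \<in> strings_ge k n w" for t
    using len[OF that] minrot_rotation[of t] minrot_le[of t] by simp (metis order_trans)
  then have ge: "count_ge k n w q = card {t \<in> strings_ge k n w. q \<le> minrot t}"
    using assms(2) by (simp add: count_ge_def cong: conj_cong)
  have "\<exists>t\<in>strings_ge k n w. minrot t = q"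
  proof (rule ccontr)
    assume "\<not> ?thesis"
    then have "{t \<in> strings_ge k n w. q < minrot t} = {t \<in> strings_ge k n w. q \<le> minrot t}"
      by (auto simp: order.strict_iff_order)
    then show False
      using assms(1) unfolding located_def gt ge by auto
  qed
  then have "q \<in> strings_ge k n w" "necklace q"
    using minrot_rotation rotate_in_strings_ge necklace_minrot by metis+
  then show "r \<le> n + count_gt k n w q"
    and "ucycle k n w ! (card (strings_ge k n w) - r) = q ! (n + count_gt k n w q - r)"
    using ucycle_nth[OF assms(3), of q k w r] assms(1,3) gt ge length_ucycle
    by (simp_all add: located_def)
qed

section \<open>Closed forms for block weights and for the length of the cycle\<close>

lemma geometric_sum_div:
  fixes B :: nat
  assumes "2 \<le> B" "d \<le> k"
  shows "(\<Sum>a\<in>{d<..k}. B ^ (s + a)) = (B ^ (s + k + 1) - B ^ (s + d + 1)) div (B - 1)"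
proof -
  have "(B - 1) * (\<Sum>a\<in>{d<..k}. B ^ (s + a)) + B ^ (s + d + 1) = B ^ (s + k + 1)"
    using assms(2)
  proof (induction k rule: dec_induct)
    case (step k)
    have "{d<..Suc k} = insert (Suc k) {d<..k}"
      using step(1) by auto
    then have "(B - 1) * (\<Sum>a\<in>{d<..Suc k}. B ^ (s + a)) + B ^ (s + d + 1) =
        (B - 1) * B ^ (s + Suc k) + B ^ (s + k + 1)"
      using step(3) by (simp add: distrib_left)
    also have "\<dots> = (B - 1 + 1) * B ^ (s + k + 1)"
      unfolding distrib_right by simp
    also have "\<dots> = B ^ (s + Suc k + 1)"
      using assms(1) by simp
    finally show ?case .
  qed simp
  then have "B ^ (s + k + 1) - B ^ (s + d + 1) = (B - 1) * (\<Sum>a\<in>{d<..k}. B ^ (s + a))"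
    by linarith
  then show ?thesis
    using assms(1) by simp
qed

lemma sum_strings_power:
  fixes B :: nat
  shows "(\<Sum>t\<in>strings k n. B ^ sum_list t) = (\<Sum>a\<in>{0<..k}. B ^ a) ^ n"
proof (induction n)
  case 0
  have "strings k 0 = {[]}"
    by (auto simp: strings_def)
  then show ?case
    by simp
next
  case (Suc n)
  have "strings k (Suc n) = (\<lambda>(a, t). a # t) ` ({0<..k} \<times> strings k n)"
    by (fastforce simp: strings_def length_Suc_conv image_iff)
  moreover have "inj_on (\<lambda>(a, t). a # t) ({0<..k} \<times> strings k n)"
    by (auto simp: inj_on_def)
  ultimately have "(\<Sum>t\<in>strings k (Suc n). B ^ sum_list t) =
      (\<Sum>(a, t)\<in>{0<..k} \<times> strings k n. B ^ a * B ^ sum_list t)"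
    by (simp only: sum.reindex) (auto simp: power_add intro!: sum.cong)
  then show ?case
    unfolding power_Suc Suc.IH[symmetric] by (simp add: sum.cartesian_product[symmetric] sum_product)
qed

text \<open>The \<open>2\<close> in the base is needed for \<open>n = 1\<close>, where
  \<open>B - 1\<close> must still exceed \<open>k\<close>.\<close>

lemma base_bounds:
  fixes n k :: nat
  assumes "1 \<le> n" "1 \<le> k"
  shows "k ^ n < (k + 2) ^ n - 1" "n + 1 \<le> (k + 2) ^ n" "3 \<le> (k + 2) ^ n"
proof -
  obtain m where n: "n = Suc m"
    using assms(1) by (cases n) auto
  have "k ^ m \<le> (k + 2) ^ m" "1 \<le> (k + 2) ^ m"
    by (auto intro: power_mono)
  then have "k * k ^ m + 2 * 1 \<le> k * (k + 2) ^ m + 2 * (k + 2) ^ m"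
    by (intro add_mono mult_le_mono2)
  then have "k ^ n + 2 \<le> (k + 2) ^ n"
    by (simp add: n algebra_simps)
  moreover have "1 \<le> k ^ n"
    using assms(2) by simp
  moreover have "n < 2 ^ n" "(2::nat) ^ n \<le> (k + 2) ^ n"
    by (auto intro: power_mono)
  ultimately show "k ^ n < (k + 2) ^ n - 1" "n + 1 \<le> (k + 2) ^ n" "3 \<le> (k + 2) ^ n"
    by linarith+
qed

lemma card_strings_ge:
  fixes B :: nat
  assumes "1 \<le> n" "1 \<le> k" "B = (k + 2) ^ n"
  shows "card (strings_ge k n w) =
    ((B ^ (k + 1) - B) div (B - 1)) ^ n div B ^ w mod (B - 1)"
proof -
  have B: "k ^ n < B - 1" "3 \<le> B"
    using base_bounds[OF assms(1,2)] assms(3) by auto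
  have "strings_ge k n w = {t \<in> strings k n. w \<le> sum_list t}"
    by (simp add: strings_ge_def weight_def)
  then have "card (strings_ge k n w) = (\<Sum>t\<in>strings k n. B ^ sum_list t) div B ^ w mod (B - 1)"
    using card_eq_weight_sum_div_mod[OF finite_strings, of k n B w sum_list] B by (simp add: card_strings)
  also have "(\<Sum>a\<in>{0<..k}. B ^ a) = (B ^ (k + 1) - B) div (B - 1)"
    using geometric_sum_div[of B 0 k 0] B by simp
  then have "(\<Sum>t\<in>strings k n. B ^ sum_list t) = ((B ^ (k + 1) - B) div (B - 1)) ^ n"
    by (simp add: sum_strings_power)
  finally show ?thesis .
qed

locale cycle_params =
  fixes n k w :: nat
  assumes k: "1 \<le> k" and n: "1 \<le> n"
begin

definition B :: nat where "B = (k + 2) ^ n"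

definition Z :: nat where "Z = B ^ (2 * k * n + 5)"

definition numer :: "nat list \<Rightarrow> nat" where
  "numer q = (\<Sum>j<length q. Suc j * block_weight k B q j * Z ^ (n - Suc j))"

definition denom :: "nat list \<Rightarrow> nat" where
  "denom q = (\<Sum>j<length q. block_weight k B q j * Z ^ (n - Suc j))"

lemma B_bounds: "k ^ n < B - 1" "n + 1 \<le> B" "3 \<le> B"
  using base_bounds[OF n k] by (auto simp: B_def)

lemma block_weight_snoc:
  "j < length q \<Longrightarrow> block_weight k B (q @ [d]) j = block_weight k B q j"
  "d \<le> k \<Longrightarrow> block_weight k B (q @ [d]) (length q) =
     (B ^ (sum_list q + k + 1) - B ^ (sum_list q + d + 1)) div (B - 1)"
  using geometric_sum_div[of B d k "sum_list q"] B_bounds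
  by (simp_all add: block_weight_def nth_append)

text \<open>Appending a digit leaves the earlier terms unchanged, so a candidate digit costs only
  one new term.\<close>

lemma numer_denom_snoc:
  assumes "d \<le> k"
    and "b = (B ^ (sum_list q + k + 1) - B ^ (sum_list q + d + 1)) div (B - 1) * Z ^ (n - Suc (length q))"
  shows "numer (q @ [d]) = numer q + b * Suc (length q)" "denom (q @ [d]) = denom q + b"
  using assms block_weight_snoc(2)[of d q]
  by (simp_all add: numer_def denom_def block_weight_snoc(1) algebra_simps)

lemma count_gt_eq:
  assumes "prenecklace q" "set q \<subseteq> {1..k}" "length q \<le> n"
  shows "numer q * Z ^ n div (Z ^ n - denom q) mod Z div B ^ w mod (B - 1) = count_gt k n w q"
  unfolding numer_def denom_def
  using count_gt_arith[OF k n assms B_def B_bounds(1,2) Z_def] by simp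

lemma numer_denom_Nil: "numer [] = 0" "denom [] = 0"
  by (simp_all add: numer_def denom_def)

end

section \<open>Structured programs\<close>

datatype com = Block "instr list" | Seq com com (infixr ";;" 60) | While nat com

fun csize :: "com \<Rightarrow> nat" where
  "csize (Block ins) = length ins"
| "csize (Seq c d) = csize c + csize d"
| "csize (While x c) = csize c + 2"

text \<open>Jump targets are absolute, hence the start address \<open>l\<close>. The exit target of
  a loop lies just behind its closing \<open>Jump\<close>.\<close>

fun compile :: "com \<Rightarrow> nat \<Rightarrow> program" where
  "compile (Block ins) l = ins"
| "compile (Seq c d) l = compile c l @ compile d (l + csize c)"
| "compile (While x c) l = JumpZero x (l + csize c + 2) # compile c (Suc l) @ [Jump l]"

lemma length_compile [simp]: "length (compile c l) = csize c"
  by (induction c arbitrary: l) auto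

definition code_at :: "program \<Rightarrow> nat \<Rightarrow> program \<Rightarrow> bool" where
  "code_at P l ins \<longleftrightarrow> (\<exists>xs ys. P = xs @ ins @ ys \<and> length xs = l)"

lemma code_at_append:
  "code_at P l (ins @ js) \<Longrightarrow> code_at P l ins \<and> code_at P (l + length ins) js"
  unfolding code_at_def by (metis append.assoc length_append)

lemma code_at_Cons:
  assumes "code_at P l (i # ins)"
  shows "l < length P" "P ! l = i" "code_at P (Suc l) ins"
proof -
  obtain xs ys where P: "P = xs @ (i # ins) @ ys" "length xs = l"
    using assms by (auto simp: code_at_def)
  then show "l < length P" "P ! l = i"
    by (auto simp: nth_append)
  have "P = (xs @ [i]) @ ins @ ys"
    using P by simp
  then show "code_at P (Suc l) ins"
    using P(2) unfolding code_at_def by (metis length_append_singleton)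
qed

definition reach :: "program \<Rightarrow> nat \<Rightarrow> nat \<Rightarrow> config \<Rightarrow> config \<Rightarrow> bool" where
  "reach P S t c c' \<longleftrightarrow> c' = (step P ^^ t) c \<and>
     (\<forall>i<t. \<not> halted P ((step P ^^ i) c) \<and>
       accessed (P ! pc ((step P ^^ i) c)) ((step P ^^ i) c) \<subseteq> {..<S})"

lemma reach_refl: "reach P S 0 c c"
  by (simp add: reach_def)

lemma reach_trans:
  assumes "reach P S t c c'" "reach P S t' c' c''"
  shows "reach P S (t + t') c c''"
proof -
  have eq: "(step P ^^ (t + i)) c = (step P ^^ i) c'" for i
    using assms(1) by (simp add: reach_def add.commute[of t] funpow_add)
  have "\<not> halted P ((step P ^^ i) c) \<and> accessed (P ! pc ((step P ^^ i) c)) ((step P ^^ i) c) \<subseteq> {..<S}"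
    if "i < t + t'" for i
  proof (cases "i < t")
    case False
    then have "i = t + (i - t)" "i - t < t'"
      using that by auto
    then show ?thesis
      using assms(2) eq[of "i - t"] unfolding reach_def by metis
  qed (use assms(1) in \<open>simp add: reach_def\<close>)
  then show ?thesis
    using assms(2) eq[of t'] by (simp add: reach_def)
qed

lemma reach_step:
  assumes "pc c < length P" "accessed (P ! pc c) c \<subseteq> {..<S}"
  shows "reach P S 1 c (exec (P ! pc c) c)"
  using assms by (simp add: reach_def step_def halted_def)

section \<open>Weakest preconditions with time and space bounds\<close>

type_synonym state = "(nat \<Rightarrow> nat) \<times> nat list"

definition cfg :: "nat \<Rightarrow> state \<Rightarrow> config" where
  "cfg l s = \<lparr>pc = l, regs = fst s, out = snd s\<rparr>"

text \<open>Total correctness within \<open>T\<close> steps and the first \<open>S\<close>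
  registers; quantifying over \<open>P\<close> and \<open>l\<close> makes the triple independent of
  where the code is placed.\<close>

definition wp :: "nat \<Rightarrow> com \<Rightarrow> nat \<Rightarrow> (state \<Rightarrow> bool) \<Rightarrow> state \<Rightarrow> bool" where
  "wp S c T Q s \<longleftrightarrow> (\<forall>P l. code_at P l (compile c l) \<longrightarrow>
     (\<exists>t\<le>T. \<exists>s'. reach P S t (cfg l s) (cfg (l + csize c) s') \<and> Q s'))"

lemma wp_mono: "wp S c T Q s \<Longrightarrow> T \<le> T' \<Longrightarrow> (\<And>s. Q s \<Longrightarrow> Q' s) \<Longrightarrow> wp S c T' Q' s"
  unfolding wp_def by (meson order_trans)

lemma wp_Seq:
  assumes "wp S c T1 (wp S d T2 Q) s" "T1 + T2 \<le> T"
  shows "wp S (c ;; d) T Q s"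
  unfolding wp_def
proof (intro allI impI)
  fix P l assume "code_at P l (compile (c ;; d) l)"
  then have c: "code_at P l (compile c l)" and d: "code_at P (l + csize c) (compile d (l + csize c))"
    using code_at_append by fastforce+
  from assms(1) c obtain t1 s1 where 1: "t1 \<le> T1" "reach P S t1 (cfg l s) (cfg (l + csize c) s1)"
      "wp S d T2 Q s1"
    unfolding wp_def[of S c] by blast
  from 1(3) d obtain t2 s2 where 2: "t2 \<le> T2" "Q s2"
      "reach P S t2 (cfg (l + csize c) s1) (cfg (l + csize c + csize d) s2)"
    unfolding wp_def by blast
  have "reach P S (t1 + t2) (cfg l s) (cfg (l + csize (c ;; d)) s2)"
    using reach_trans[OF 1(2) 2(3)] by (simp add: add.assoc)
  then show "\<exists>t\<le>T. \<exists>s'. reach P S t (cfg l s) (cfg (l + csize (c ;; d)) s') \<and> Q s'"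
    using 1(1) 2(1,2) assms(2) by (metis add_mono order_trans)
qed

fun block_wp :: "nat \<Rightarrow> instr list \<Rightarrow> (state \<Rightarrow> bool) \<Rightarrow> state \<Rightarrow> bool" where
  "block_wp S [] Q s = Q s"
| "block_wp S (Const a v # ins) Q (f, os) \<longleftrightarrow> a < S \<and> block_wp S ins Q (f(a := v), os)"
| "block_wp S (Copy a b # ins) Q (f, os) \<longleftrightarrow> a < S \<and> b < S \<and> block_wp S ins Q (f(a := f b), os)"
| "block_wp S (Load a b # ins) Q (f, os) \<longleftrightarrow>
     a < S \<and> b < S \<and> f b < S \<and> block_wp S ins Q (f(a := f (f b)), os)"
| "block_wp S (Store a b # ins) Q (f, os) \<longleftrightarrow>
     a < S \<and> b < S \<and> f a < S \<and> block_wp S ins Q (f(f a := f b), os)"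
| "block_wp S (Add a b d # ins) Q (f, os) \<longleftrightarrow>
     a < S \<and> b < S \<and> d < S \<and> block_wp S ins Q (f(a := f b + f d), os)"
| "block_wp S (Sub a b d # ins) Q (f, os) \<longleftrightarrow>
     a < S \<and> b < S \<and> d < S \<and> block_wp S ins Q (f(a := f b - f d), os)"
| "block_wp S (Mult a b d # ins) Q (f, os) \<longleftrightarrow>
     a < S \<and> b < S \<and> d < S \<and> block_wp S ins Q (f(a := f b * f d), os)"
| "block_wp S (Div a b d # ins) Q (f, os) \<longleftrightarrow>
     a < S \<and> b < S \<and> d < S \<and> block_wp S ins Q (f(a := f b div f d), os)"
| "block_wp S (Write a # ins) Q (f, os) \<longleftrightarrow> a < S \<and> block_wp S ins Q (f, os @ [f a])"
| "block_wp S (Jump l # ins) Q s \<longleftrightarrow> False"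
| "block_wp S (JumpZero a l # ins) Q s \<longleftrightarrow> False"

lemma block_wp_step:
  assumes "block_wp S (i # ins) Q s"
  shows "\<exists>s'. exec i (cfg l s) = cfg (Suc l) s' \<and> accessed i (cfg l s) \<subseteq> {..<S} \<and> block_wp S ins Q s'"
proof (cases s)
  case (Pair f os)
  then show ?thesis
    using assms by (cases i) (auto simp: cfg_def set_reg_def)
qed

lemma block_wp_reach:
  assumes "code_at P l ins" "block_wp S ins Q s"
  shows "\<exists>s'. reach P S (length ins) (cfg l s) (cfg (l + length ins) s') \<and> Q s'"
  using assms
proof (induction "ins" arbitrary: l s)
  case Nil
  then show ?case
    using reach_refl[of P S "cfg l s"] by (intro exI[of _ s]) simp
next
  case (Cons i js)
  obtain s' where s': "exec i (cfg l s) = cfg (Suc l) s'" "accessed i (cfg l s) \<subseteq> {..<S}"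
      "block_wp S js Q s'"
    using block_wp_step[OF Cons.prems(2)] by blast
  have pc: "pc (cfg l s) = l"
    by (simp add: cfg_def)
  have "reach P S 1 (cfg l s) (cfg (Suc l) s')"
    using reach_step[of "cfg l s" P S] code_at_Cons[OF Cons.prems(1)] s' unfolding pc by simp
  moreover obtain s'' where "reach P S (length js) (cfg (Suc l) s') (cfg (Suc l + length js) s'')" "Q s''"
    using Cons.IH[OF code_at_Cons(3)[OF Cons.prems(1)] s'(3)] by blast
  ultimately show ?case
    using reach_trans by fastforce
qed

lemma wp_Block:
  assumes "block_wp S ins Q s" "length ins \<le> T"
  shows "wp S (Block ins) T Q s"
  unfolding wp_def using block_wp_reach[OF _ assms(1)] assms(2) by fastforce

text \<open>The index of \<open>I\<close> bounds the remaining iterations. An iteration costs the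
  test, the body and the closing jump, hence \<open>T + 2\<close>; the last test adds 1.\<close>

lemma wp_While:
  assumes "I N s" "x < S" "N * (T + 2) + 1 \<le> T'"
    and exit: "\<And>i s. I i s \<Longrightarrow> fst s x = 0 \<Longrightarrow> Q s"
    and body: "\<And>i s. I i s \<Longrightarrow> fst s x \<noteq> 0 \<Longrightarrow> 0 < i \<and> wp S c T (I (i - 1)) s"
  shows "wp S (While x c) T' Q s"
  unfolding wp_def
proof (intro allI impI)
  fix P l assume code: "code_at P l (compile (While x c) l)"
  define e where "e = l + csize (While x c)"
  have head: "l < length P" "P ! l = JumpZero x e"
    using code code_at_Cons[of P l] by (auto simp: e_def)
  have "code_at P (Suc l) (compile c (Suc l) @ [Jump l])"
    using code code_at_Cons(3)[of P l] by simp
  then have c: "code_at P (Suc l) (compile c (Suc l))" and "code_at P (Suc l + csize c) [Jump l]"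
    using code_at_append by fastforce+
  then have jmp: "Suc l + csize c < length P" "P ! (Suc l + csize c) = Jump l"
    using code_at_Cons by blast+
  have pc: "pc (cfg j s) = j" for j :: nat and s :: state
    by (simp add: cfg_def)
  have test: "reach P S 1 (cfg l s) (if fst s x = 0 then cfg e s else cfg (Suc l) s)" for s
    using reach_step[of "cfg l s" P S] head assms(2) unfolding pc by (auto simp: cfg_def)
  have jump: "reach P S 1 (cfg (Suc l + csize c) s) (cfg l s)" for s
    using reach_step[of "cfg (Suc l + csize c) s" P S] jmp unfolding pc by (simp add: cfg_def)
  have "\<exists>t\<le>N * (T + 2) + 1. \<exists>s'. reach P S t (cfg l s) (cfg e s') \<and> Q s'" if "I N s" for N s
    using that
  proof (induction N arbitrary: s)
    case 0
    then have "fst s x = 0"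
      using body by blast
    then show ?case
      using test[of s] exit[OF 0] by (intro exI[of _ 1] conjI exI[of _ s]) auto
  next
    case (Suc N)
    show ?case
    proof (cases "fst s x = 0")
      case True
      then show ?thesis
        using test[of s] exit[OF Suc.prems] by (intro exI[of _ 1] conjI exI[of _ s]) auto
    next
      case False
      then have "wp S c T (I N) s"
        using body[OF Suc.prems] by simp
      then obtain t1 s1 where 1: "t1 \<le> T" "I N s1"
          "reach P S t1 (cfg (Suc l) s) (cfg (Suc l + csize c) s1)"
        using c unfolding wp_def by blast
      obtain t2 s2 where 2: "t2 \<le> N * (T + 2) + 1" "reach P S t2 (cfg l s1) (cfg e s2)" "Q s2"
        using Suc.IH[OF 1(2)] by blast
      have "reach P S (1 + t1 + 1 + t2) (cfg l s) (cfg e s2)"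
        using test[of s] False reach_trans 1(3) jump[of s1] 2(2) by (smt (verit))
      moreover have "1 + t1 + 1 + t2 \<le> Suc N * (T + 2) + 1"
        using 1(1) 2(1) by simp
      ultimately show ?thesis
        using 2(3) by blast
    qed
  qed
  then show "\<exists>t\<le>T'. \<exists>s'. reach P S t (cfg l s) (cfg (l + csize (While x c)) s') \<and> Q s'"
    using assms(1,3) unfolding e_def by (meson order_trans)
qed

lemma wp_computes_in:
  assumes "wp S c T (\<lambda>s. snd s = ys) (regs (init xs), [])" "length xs \<le> S"
  shows "\<exists>t\<le>T. computes_in (compile c 0) xs ys t S"
proof -
  let ?P = "compile c 0"
  have "code_at ?P 0 ?P"
    by (auto simp: code_at_def)
  then obtain t s' where t: "t \<le> T" "reach ?P S t (cfg 0 (regs (init xs), [])) (cfg (csize c) s')"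
      "snd s' = ys"
    using assms(1) unfolding wp_def by fastforce
  have "cfg 0 (regs (init xs), []) = init xs"
    by (simp add: cfg_def init_def)
  then show ?thesis
    using t assms(2) unfolding computes_in_def reach_def run_def
    by (intro exI[of _ t]) (auto simp: halted_def cfg_def dest: sym)
qed

section \<open>The unranking program\<close>

text \<open>
  Registers 0 to 2 hold \<open>n\<close>, \<open>k\<close> and \<open>w\<close>. Register 3 holds the number of positions from the current
  one to the end of the cycle, so that strings are counted from the largest necklace downwards.
  The further constants are \<open>1\<close> in 4, \<open>B\<close> in 5, \<open>B\<^sup>w\<close> in 6, \<open>Z\<close> in 7, \<open>Z\<^sup>n\<close> in 8, the length of the
  cycle in 9 and \<open>B - 1\<close> in 27; 10 is the number of symbols still to be written.
  The prefix \<open>q\<close> found so far is stored from register 31 on, with its length in 11, the numerator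
  and denominator sums in 12 and 13, its digit sum in 14, its least period \<open>p\<close> in 15 and the number
  of missing digits in 29. Register 30 holds 1, so that the lower bound for the next digit is at
  address \<open>31 + |q| - p\<close> for empty \<open>q\<close> (with \<open>p = 1\<close>) as well. The candidate digit is in 16, the
  corresponding count in 18 and the new sums in 19 and 20. The power routine takes base and
  exponent in 21 and 22 and puts the result into 23.
\<close>

definition power_com :: com where
  "power_com = Block [Const 23 1] ;; While 22 (Block [Mult 23 23 21, Sub 22 22 4])"

definition block_weight_com :: com where
  "block_weight_com =
     Block [Copy 21 5, Add 22 14 1, Add 22 22 4] ;; power_com ;;
     Block [Copy 24 23, Add 22 14 16, Add 22 22 4] ;; power_com ;;
     Block [Sub 24 24 23, Div 24 24 27, Copy 21 7, Sub 22 0 11, Sub 22 22 4] ;; power_com ;;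
     Block [Mult 24 24 23]"

definition count_com :: com where
  "count_com = block_weight_com ;;
     Block [Add 20 13 24, Add 25 11 4, Mult 24 24 25, Add 19 12 24] ;;
     Block [Mult 24 19 8, Sub 25 8 20, Div 24 24 25, Div 25 24 7, Mult 25 25 7, Sub 24 24 25,
       Div 24 24 6, Div 25 24 27, Mult 25 25 27, Sub 18 24 25, Add 17 18 4, Sub 17 17 3]"

definition digit_com :: com where
  "digit_com =
     Block [Const 25 31, Add 25 25 11, Sub 25 25 15, Load 26 25, Sub 16 26 4, Const 17 1] ;;
     While 17 (Block [Add 16 16 4] ;; count_com) ;;
     Block [Copy 12 19, Copy 13 20, Add 14 14 16, Const 25 31, Add 25 25 11, Store 25 16,
       Add 11 11 4, Sub 24 16 26, Sub 25 4 24, Sub 24 4 25, Mult 24 24 11, Mult 15 15 25,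
       Add 15 15 24, Sub 29 0 11]"

definition symbol_com :: com where
  "symbol_com =
     Block [Const 11 0, Const 12 0, Const 13 0, Const 14 0, Const 15 1, Copy 29 0] ;;
     While 29 digit_com ;;
     Block [Const 25 31, Add 25 25 0, Add 25 25 18, Sub 25 25 3, Load 24 25, Write 24,
       Sub 3 3 4, Sub 25 4 3, Mult 25 25 9, Add 3 3 25, Sub 10 10 4]"

definition prepare_com :: com where
  "prepare_com =
     Block [Const 4 1, Const 30 1, Const 24 2, Add 21 1 24, Copy 22 0] ;; power_com ;;
     Block [Copy 5 23, Sub 27 5 4, Copy 21 5, Copy 22 2] ;; power_com ;;
     Block [Copy 6 23, Mult 22 0 1, Const 24 2, Mult 22 24 22, Const 24 5, Add 22 22 24] ;; power_com ;;
     Block [Copy 7 23, Copy 21 7, Copy 22 0] ;; power_com ;;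
     Block [Copy 8 23, Copy 21 5, Add 22 1 4] ;; power_com ;;
     Block [Sub 24 23 5, Div 21 24 27, Copy 22 0] ;; power_com ;;
     Block [Div 24 23 6, Div 25 24 27, Mult 25 25 27, Sub 9 24 25, Add 24 9 4, Sub 3 24 3, Copy 10 0]"

definition unrank_com :: com where
  "unrank_com = prepare_com ;; While 10 symbol_com"

section \<open>Verification of the unranking program\<close>

lemma wp_le: "wp S c T Q s \<Longrightarrow> T \<le> T' \<Longrightarrow> wp S c T' Q s"
  by (rule wp_mono)

lemma wp_Seq_assert:
  "wp S c T1 R s \<Longrightarrow> (\<And>s. R s \<Longrightarrow> wp S d T2 Q s) \<Longrightarrow> T1 + T2 \<le> T \<Longrightarrow> wp S (c ;; d) T Q s"
  by (rule wp_Seq[OF wp_mono[OF _ order_refl]])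

lemma wp_Seq_exact:
  "wp S c T1 (\<lambda>s. s = s') s \<Longrightarrow> wp S d T2 Q s' \<Longrightarrow> T1 + T2 \<le> T \<Longrightarrow> wp S (c ;; d) T Q s"
  by (rule wp_Seq_assert[where R = "\<lambda>x. x = s'"]) simp_all

lemma wp_BlockI: "block_wp S ins Q s \<Longrightarrow> wp S (Block ins) (length ins) Q s"
  by (rule wp_Block) simp_all

lemma wp_Block_Seq:
  "block_wp S ins (wp S d T Q) s \<Longrightarrow> wp S (Block ins ;; d) (length ins + T) Q s"
  by (rule wp_Seq[OF wp_BlockI order_refl])

text \<open>Each iteration takes a test, two instructions and a jump; initialization and last test
  add 2.\<close>

lemma wp_power:
  assumes "f 4 = 1" "f 22 \<le> X" "23 < S" "Q (f(22 := 0, 23 := f 21 ^ f 22), os)"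
  shows "wp S power_com (4 * X + 2) Q (f, os)"
proof -
  let ?I = "\<lambda>i s. \<exists>e\<le>f 22. i = e \<and> s = (f(22 := e, 23 := f 21 ^ (f 22 - e)), os)"
  have "wp S (While 22 (Block [Mult 23 23 21, Sub 22 22 4])) (4 * X + 1) Q
      (f(23 := 1), os)"
  proof (rule wp_While[where I = ?I and N = "f 22" and T = 2])
    show "?I (f 22) (f(23 := 1), os)"
      by (auto simp: fun_eq_iff)
  next
    fix i s assume "?I i s" "fst s 22 = 0"
    then show "Q s"
      using assms(4) by auto
  next
    fix i s assume I: "?I i s" and "fst s 22 \<noteq> 0"
    then obtain e where e: "i = Suc e" "Suc e \<le> f 22" "s = (f(22 := Suc e, 23 := f 21 ^ (f 22 - Suc e)), os)"
      by (auto simp: gr0_conv_Suc)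
    have "f 21 ^ (f 22 - Suc e) * f 21 = f 21 ^ (f 22 - e)"
      using e(2) by (metis Suc_diff_Suc Suc_le_eq power_Suc2)
    then show "0 < i \<and> wp S (Block [Mult 23 23 21, Sub 22 22 4]) 2 (?I (i - 1)) s"
      using e assms(1,3) by (auto intro!: wp_Block exI[of _ e] simp: fun_eq_iff)
  qed (use assms in auto)
  then show ?thesis
    unfolding power_com_def using assms(3) by (intro wp_le[OF wp_Block_Seq]) auto
qed

lemma wp_power_Seq:
  assumes "f 4 = 1" "f 22 \<le> X" "23 < S" "wp S d T Q (f(22 := 0, 23 := f 21 ^ f 22), os)"
  shows "wp S (power_com ;; d) (4 * X + 2 + T) Q (f, os)"
  using assms by (intro wp_Seq[OF wp_power order_refl])

context cycle_params
begin

definition len :: nat where "len = card (strings_ge k n w)"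

definition exp_bound :: nat where "exp_bound = 2 * k * n + 5"

definition constants :: "(nat \<Rightarrow> nat) \<Rightarrow> bool" where
  "constants f \<longleftrightarrow> f 0 = n \<and> f 1 = k \<and> f 4 = 1 \<and> f 5 = B \<and> f 6 = B ^ w \<and> f 7 = Z \<and> f 8 = Z ^ n \<and>
     f 9 = len \<and> f 27 = B - 1 \<and> f 30 = 1"

lemma exp_bound_ge:
  shows "n \<le> exp_bound" "w \<le> k * n \<Longrightarrow> w \<le> exp_bound" "k * n + 1 \<le> exp_bound" "Suc k \<le> exp_bound" "2 * (n * k) + 5 \<le> exp_bound"
proof -
  have "k \<le> k * n" "n \<le> k * n"
    using k n by auto
  moreover have "2 * k * n = k * n + k * n" "n * k = k * n"
    by simp_all
  ultimately show "n \<le> exp_bound" "w \<le> k * n \<Longrightarrow> w \<le> exp_bound" "k * n + 1 \<le> exp_bound" "Suc k \<le> exp_bound" "2 * (n * k) + 5 \<le> exp_bound"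
    unfolding exp_bound_def by linarith+
qed

lemma wp_prepare:
  assumes S: "31 + n \<le> S" and w: "w \<le> k * n" and f: "f 0 = n" "f 1 = k" "f 2 = w"
    and Q: "\<And>f'. constants f' \<Longrightarrow> f' 3 = len + 1 - f 3 \<Longrightarrow> f' 10 = n \<Longrightarrow> Q (f', os)"
  shows "wp S prepare_com (24 * exp_bound + 50) Q (f, os)"
proof -
  have [simp]: "f 0 = n" "f (Suc 0) = k" "f 2 = w"
    using f by auto
  have S': "j < S" if "j \<le> 30" for j
    using S that by simp
  have [simp]: "Suc (Suc k) ^ n = B"
    by (simp add: B_def)
  have [simp]: "B ^ (2 * (n * k) + 5) = Z"
    by (simp add: Z_def ac_simps)
  have [simp]: "((B * B ^ k - B) div (B - Suc 0)) ^ n div B ^ w mod (B - Suc 0) = len"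
    using card_strings_ge[OF n k B_def] by (simp add: len_def)
  note [simp] = exp_bound_ge(1,4,5) exp_bound_ge(2)[OF w] S'
  show ?thesis
    unfolding prepare_com_def
    apply (rule wp_le)
     apply (rule wp_Block_Seq, simp, rule wp_power_Seq[where X = exp_bound], simp, simp, simp)+
     apply (rule wp_BlockI, simp add: minus_div_mult_eq_mod)
     apply (rule Q)
       apply (simp_all add: constants_def)
    done
qed

definition searching :: "nat list \<Rightarrow> (nat \<Rightarrow> nat) \<Rightarrow> bool" where
  "searching q f \<longleftrightarrow> constants f \<and> length q < n \<and> set q \<subseteq> {1..k} \<and> f 11 = length q \<and>
     f 12 = numer q \<and> f 13 = denom q \<and> f 14 = sum_list q"

lemma wp_block_weight:
  assumes S: "31 + n \<le> S" and q: "searching q f" and d: "f 16 = d" "d \<le> k"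
  shows "wp S block_weight_com (12 * exp_bound + 18) (\<lambda>(f', os'). os' = os \<and>
    (\<forall>x. x < 17 \<or> 25 < x \<longrightarrow> f' x = f x) \<and>
    f' 24 = (B ^ (sum_list q + k + 1) - B ^ (sum_list q + d + 1)) div (B - 1) * Z ^ (n - Suc (length q))) (f, os)"
proof -
  have "set q \<subseteq> {..k}"
    using q by (auto simp: searching_def)
  then have "sum_list q \<le> k * length q"
    by (rule sum_list_le_mult_length)
  also have "\<dots> \<le> k * (n - 1)"
    using q by (intro mult_le_mono2) (auto simp: searching_def)
  finally have "sum_list q + k + 1 \<le> k * n + 1"
    using n by (cases n) auto
  also have "\<dots> \<le> exp_bound"
    by (rule exp_bound_ge)
  finally have exps: "Suc (sum_list q + k) \<le> exp_bound" "Suc (sum_list q + d) \<le> exp_bound" "n - Suc (length q) \<le> exp_bound"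
    using d exp_bound_ge(1) by auto
  have [simp]: "f 0 = n" "f (Suc 0) = k" "f 4 = 1" "f 5 = B" "f 7 = Z" "f 27 = B - 1" "f 11 = length q"
      "f 14 = sum_list q" "f 16 = d"
    using q d by (auto simp: constants_def searching_def)
  have S': "j < S" if "j \<le> 30" for j
    using S that by simp
  note [simp] = exps S'
  show ?thesis
    unfolding block_weight_com_def
    apply (rule wp_le)
     apply (rule wp_Block_Seq, simp, rule wp_power_Seq[where X = exp_bound], simp, simp, simp)+
     apply (rule wp_BlockI, simp_all)
    done
qed

text \<open>Residues are obtained by subtracting the rounded-down multiple. By truncated subtraction
  register 17 is 0 iff the count is below register 3, which ends the search.\<close>

lemma wp_count:
  assumes S: "31 + n \<le> S" and q: "searching q f" and d: "f 16 = d" "1 \<le> d" "d \<le> k"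
    and pre: "prenecklace (q @ [d])"
  shows "wp S count_com (12 * exp_bound + 34) (\<lambda>(f', os'). os' = os \<and>
    (\<forall>x. x < 17 \<or> 25 < x \<longrightarrow> f' x = f x) \<and> f' 18 = count_gt k n w (q @ [d]) \<and>
    f' 17 = f' 18 + 1 - f 3 \<and> f' 19 = numer (q @ [d]) \<and> f' 20 = denom (q @ [d])) (f, os)"
  unfolding count_com_def
proof (rule wp_Seq_assert[OF wp_block_weight[OF S q d(1,3)]], clarify)
  fix f' :: "nat \<Rightarrow> nat"
  define b where "b = (B ^ (sum_list q + k + 1) - B ^ (sum_list q + d + 1)) div (B - 1) * Z ^ (n - Suc (length q))"
  assume frame: "\<forall>x. x < 17 \<or> 25 < x \<longrightarrow> f' x = f x"
    and "f' 24 = (B ^ (sum_list q + k + 1) - B ^ (sum_list q + d + 1)) div (B - 1) * Z ^ (n - Suc (length q))"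
  then have [simp]: "f' 24 = b"
    by (simp add: b_def)
  note snoc = numer_denom_snoc[OF d(3) b_def]
  have [simp]: "count_gt k n w (q @ [d]) =
      (numer q + b * Suc (length q)) * Z ^ n div (Z ^ n - (denom q + b)) mod Z div B ^ w mod (B - 1)"
    using count_gt_eq[OF pre] q d unfolding snoc searching_def by simp
  have [simp]: "f 4 = 1" "f 6 = B ^ w" "f 7 = Z" "f 8 = Z ^ n" "f 27 = B - 1" "f 11 = length q"
      "f 12 = numer q" "f 13 = denom q"
    using q by (auto simp: constants_def searching_def)
  have S': "j < S" if "j \<le> 30" for j
    using S that by simp
  note [simp] = S'
  show "wp S (Block [Add 20 13 24, Add 25 11 4, Mult 24 24 25, Add 19 12 24] ;;
     Block [Mult 24 19 8, Sub 25 8 20, Div 24 24 25, Div 25 24 7, Mult 25 25 7, Sub 24 24 25,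
       Div 24 24 6, Div 25 24 27, Mult 25 25 27, Sub 18 24 25, Add 17 18 4, Sub 17 17 3]) 16
     (\<lambda>(f', os'). os' = os \<and>
    (\<forall>x. x < 17 \<or> 25 < x \<longrightarrow> f' x = f x) \<and> f' 18 = count_gt k n w (q @ [d]) \<and>
    f' 17 = f' 18 + 1 - f 3 \<and> f' 19 = numer (q @ [d]) \<and> f' 20 = denom (q @ [d])) (f', os)"
    apply (rule wp_le)
     apply (rule wp_Block_Seq, simp add: frame, rule wp_BlockI)
     apply (simp add: frame minus_div_mult_eq_mod snoc)
    apply simp
    done
qed simp

text \<open>The last conjunct remembers that the preceding candidate was rejected, as
  \<open>located_snoc\<close> requires; the least digit has no preceding candidate.\<close>

definition found :: "nat \<Rightarrow> nat list \<Rightarrow> nat \<Rightarrow> nat \<Rightarrow> (nat \<Rightarrow> nat) \<Rightarrow> bool" where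
  "found r q p d f \<longleftrightarrow> min_next q p \<le> d \<and> d \<le> k \<and> f 16 = d \<and> f 18 = count_gt k n w (q @ [d]) \<and>
     f 19 = numer (q @ [d]) \<and> f 20 = denom (q @ [d]) \<and>
     (d = min_next q p \<or> r \<le> count_gt k n w (q @ [d - 1]))"

text \<open>The candidate starts one below the least digit and register 17 at 1, so at least one
  digit is tried. \<open>count_gt_snoc_max\<close> excludes a rejection at \<open>k\<close>, which
  makes \<open>k\<close> minus the candidate a variant.\<close>

lemma wp_search:
  assumes S: "31 + n \<le> S" and q: "searching q f" and loc: "located k n w r q p"
    and f: "f 3 = r" "f 16 = min_next q p - 1" "f 17 = 1"
  shows "wp S (While 17 (Block [Add 16 16 4] ;; count_com)) (k * (12 * exp_bound + 37) + 1) (\<lambda>(f', os'). os' = os \<and>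
    (\<forall>x. x < 16 \<or> 25 < x \<longrightarrow> f' x = f x) \<and> f' 18 < r \<and> (\<exists>d. found r q p d f')) (f, os)"
proof -
  let ?I = "\<lambda>i (f', os'). os' = os \<and> (\<forall>x. x < 16 \<or> 25 < x \<longrightarrow> f' x = f x) \<and> f' 16 \<le> k \<and> i = k - f' 16 \<and>
    (f' 16 = min_next q p - 1 \<and> f' 17 = 1 \<or> f' 17 = f' 18 + 1 - r \<and> found r q p (f' 16) f')"
  have loc': "prenecklace q" "least_period q p" "count_gt k n w q < r" "length q < n" "set q \<subseteq> {1..k}"
    using loc q by (auto simp: located_def searching_def)
  have d0: "1 \<le> min_next q p" "min_next q p \<le> k"
    using min_next_bounds[OF loc'(5,2) k] by auto
  show ?thesis
  proof (rule wp_While[where I = ?I and N = "k - f 16" and T = "12 * exp_bound + 35"])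
    show "?I (k - f 16) (f, os)"
      using f d0 by simp
  next
    fix i s assume I: "?I i s" and "fst s 17 = 0"
    obtain f' os' where s: "s = (f', os')"
      by (cases s)
    show "case s of (f', os') \<Rightarrow> os' = os \<and> (\<forall>x. x < 16 \<or> 25 < x \<longrightarrow> f' x = f x) \<and> f' 18 < r \<and> (\<exists>d. found r q p d f')"
      using I \<open>fst s 17 = 0\<close> unfolding s by auto
  next
    fix i s assume I: "?I i s" and nz: "fst s 17 \<noteq> 0"
    obtain f' os' where s: "s = (f', os')"
      by (cases s)
    define d where "d = f' 16"
    have frame: "f' x = f x" if "x < 16 \<or> 25 < x" for x
      using I that unfolding s by auto
    have "found r q p d f' \<and> r \<le> count_gt k n w (q @ [d]) \<or> d = min_next q p - 1"
      using I nz unfolding s by (auto simp: d_def found_def)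
    moreover have "d \<noteq> k" if "r \<le> count_gt k n w (q @ [d])"
      using that count_gt_snoc_max[OF loc'(4), of k w] loc'(3) by auto
    moreover have "d \<le> k"
      using I by (simp add: s d_def)
    moreover have "min_next q p \<le> d" if "found r q p d f'"
      using that by (simp add: found_def)
    ultimately have "d < k \<and> min_next q p \<le> d \<and> r \<le> count_gt k n w (q @ [d]) \<or> d = min_next q p - 1"
      by (meson le_neq_implies_less)
    then have d: "d < k" "min_next q p \<le> Suc d" "Suc d = min_next q p \<or> r \<le> count_gt k n w (q @ [d])"
      using d0 by auto
    have pre: "prenecklace (q @ [Suc d])"
      using prenecklace_snoc[OF loc'(1,2)] d(2) by simp
    have srch: "searching q (f'(16 := Suc d))"
      using q frame by (simp add: searching_def constants_def)
    have "wp S count_com (12 * exp_bound + 34) (?I (i - 1)) (f'(16 := Suc d), os)"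
    proof (rule wp_mono[OF wp_count[OF S srch _ _ _ pre] order_refl])
      fix s' :: state
      assume post: "case s' of (g, os') \<Rightarrow> os' = os \<and>
        (\<forall>x. x < 17 \<or> 25 < x \<longrightarrow> g x = (f'(16 := Suc d)) x) \<and> g 18 = count_gt k n w (q @ [Suc d]) \<and>
        g 17 = g 18 + 1 - (f'(16 := Suc d)) 3 \<and> g 19 = numer (q @ [Suc d]) \<and> g 20 = denom (q @ [Suc d])"
      obtain g where s': "s' = (g, os)"
        using post by (cases s') simp
      have g: "g x = (f'(16 := Suc d)) x" if "x < 17 \<or> 25 < x" for x
        using post that by (auto simp: s')
      have "g x = f x" if "x < 16 \<or> 25 < x" for x
        using g[of x] frame[of x] that by auto
      moreover have "found r q p (Suc d) g" "g 17 = g 18 + 1 - r" "g 16 = Suc d"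
        using post d g[of 16] frame[of 3] f(1) by (simp_all add: s' found_def)
      moreover have "i = k - d"
        using I by (simp add: s d_def)
      ultimately show "?I (i - 1) s'"
        using d(1) by (simp add: s')
    qed (use d in simp_all)
    then have "wp S (Block [Add 16 16 4] ;; count_com) (12 * exp_bound + 35) (?I (i - 1)) s"
    proof -
      have "f' 4 = 1" "f' 16 = d" "s = (f', os)"
        using q frame[of 4] I by (simp_all add: searching_def constants_def d_def s)
      then show ?thesis
        using S \<open>wp S count_com _ _ _\<close> by (intro wp_le[OF wp_Block_Seq[where T = "12 * exp_bound + 34"]]) simp_all
    qed
    then show "0 < i \<and> wp S (Block [Add 16 16 4] ;; count_com) (12 * exp_bound + 35) (?I (i - 1)) s"
      using I d(1) by (simp add: s d_def)
  next
    show "(k - f 16) * (12 * exp_bound + 35 + 2) + 1 \<le> k * (12 * exp_bound + 37) + 1"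
      using mult_le_mono1[of "k - f 16" k "12 * exp_bound + 37"] by (simp add: add.commute)
  qed (use S in simp)
qed

definition digits :: "nat list \<Rightarrow> nat \<Rightarrow> (nat \<Rightarrow> nat) \<Rightarrow> bool" where
  "digits q p f \<longleftrightarrow> constants f \<and> f 11 = length q \<and> f 12 = numer q \<and> f 13 = denom q \<and>
     f 14 = sum_list q \<and> f 15 = p \<and> (\<forall>i<length q. f (31 + i) = q ! i)"

lemma wp_digit:
  assumes S: "31 + n \<le> S" and q: "digits q p f" "length q < n" and loc: "located k n w r q p" and r: "f 3 = r"
  shows "wp S digit_com (k * (12 * exp_bound + 37) + 21) (\<lambda>(f', os'). os' = os \<and> f' 3 = r \<and> f' 10 = f 10 \<and>
    f' 29 = n - Suc (length q) \<and>
    (\<exists>q' p'. length q' = Suc (length q) \<and> digits q' p' f' \<and> located k n w r q' p' \<and>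
       f' 18 = count_gt k n w q')) (f, os)"
proof -
  have loc': "prenecklace q" "least_period q p" "set q \<subseteq> {1..k}"
    using loc by (auto simp: located_def)
  have d0: "1 \<le> min_next q p" "min_next q p \<le> k"
    using min_next_bounds[OF loc'(3,2) k] by auto
  have load: "f (31 + length q - p) = min_next q p" "31 + length q - p < S" "25 < 31 + length q - p"
  proof -
    show "f (31 + length q - p) = min_next q p"
    proof (cases "q = []")
      case True
      then have "p = 1"
        using loc'(2) by (auto simp: least_period_def)
      then show ?thesis
        using True q by (simp add: min_next_def digits_def constants_def)
    next
      case False
      then have "1 \<le> p" "p \<le> length q"
        using loc'(2) by (auto simp: least_period_def Suc_le_eq)
      then have "31 + length q - p = 31 + (length q - p)" "length q - p < length q"
        by auto
      moreover from this(2) have "f (31 + (length q - p)) = q ! (length q - p)"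
        using q(1) unfolding digits_def by blast
      ultimately show ?thesis
        using False unfolding min_next_def by metis
    qed
    show "31 + length q - p < S" "25 < 31 + length q - p"
      using S q(2) loc'(2) by (auto simp: least_period_def)
  qed
  have S': "j < S" if "j \<le> 30" for j
    using S that by simp
  have reg: "f 0 = n" "f 4 = 1" "f 11 = length q" "f 12 = numer q" "f 13 = denom q" "f 14 = sum_list q"
      "f 15 = p" "f 30 = 1"
    using q by (auto simp: digits_def constants_def)
  define f1 where "f1 = f(25 := 31 + length q - p, 26 := min_next q p, 16 := min_next q p - 1, 17 := 1)"
  have start: "searching q f1" "f1 3 = r" "f1 16 = min_next q p - 1" "f1 17 = 1"
    using q loc' r by (auto simp: f1_def searching_def digits_def constants_def)
  let ?Q = "\<lambda>(f', os'). os' = os \<and> f' 3 = r \<and> f' 10 = f 10 \<and> f' 29 = n - Suc (length q) \<and>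
    (\<exists>q' p'. length q' = Suc (length q) \<and> digits q' p' f' \<and> located k n w r q' p' \<and> f' 18 = count_gt k n w q')"
  let ?R = "\<lambda>(f', os'). os' = os \<and> (\<forall>x. x < 16 \<or> 25 < x \<longrightarrow> f' x = f1 x) \<and> f' 18 < r \<and> (\<exists>d. found r q p d f')"
  have "wp S (Block [Copy 12 19, Copy 13 20, Add 14 14 16, Const 25 31, Add 25 25 11, Store 25 16,
       Add 11 11 4, Sub 24 16 26, Sub 25 4 24, Sub 24 4 25, Mult 24 24 11, Mult 15 15 25,
       Add 15 15 24, Sub 29 0 11]) 14 ?Q s" if R: "?R s" for s
  proof -
    obtain f' os' where s': "s = (f', os')"
      by (cases s)
    obtain d where s: "s = (f', os)" and frame: "\<And>x. x < 16 \<or> 25 < x \<Longrightarrow> f' x = f1 x"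
      and less: "f' 18 < r" and d: "found r q p d f'"
      using R unfolding s' by auto
    have d': "min_next q p \<le> d" "d \<le> k" "1 \<le> d"
      using d d0 by (auto simp: found_def)
    define p' where "p' = (if min_next q p < d then Suc (length q) else p)"
    have loc'': "located k n w r (q @ [d]) p'"
      using located_snoc[OF loc q(2) d'(1,3,2)] d less by (simp add: found_def p'_def)
    \<comment> \<open>A branch-free test for \<open>d = min_next q p\<close>: the new period is the
      flag times \<open>p\<close> plus its complement times \<open>Suc (length q)\<close>.\<close>
    have flag: "Suc 0 - (d - min_next q p) = (if min_next q p < d then 0 else 1)"
      using d' by auto
    have [simp]: "f' 0 = n" "f' 4 = 1" "f' 11 = length q" "f' 14 = sum_list q" "f' 15 = p" "f' 26 = min_next q p"
        "f' 16 = d" "f' 18 = count_gt k n w (q @ [d])" "f' 19 = numer (q @ [d])" "f' 20 = denom (q @ [d])"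
        "f' 3 = r" "f' 10 = f 10" "f' (Suc 0) = k"
      using frame start(2) d reg q(1) by (auto simp: f1_def found_def digits_def constants_def)
    have const: "f' x = f x" if "x < 11 \<or> x \<in> {27, 30} \<or> 31 \<le> x" for x
      using frame that by (auto simp: f1_def)
    have digits: "digits (q @ [d]) p' f'" if "f' 11 = Suc (length q)" "f' 12 = numer (q @ [d])" "f' 13 = denom (q @ [d])"
      "f' 14 = sum_list q + d" "f' 15 = p'" "f' (31 + length q) = d"
      "\<And>x. x < 11 \<and> x \<noteq> 3 \<or> x \<in> {27, 30} \<or> 31 \<le> x \<and> x \<noteq> 31 + length q \<Longrightarrow> f' x = f x" for f'
      using that q(1) by (auto simp: digits_def constants_def nth_append less_Suc_eq)
    have "31 + length q < S"
      using S q(2) by simp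
    then show ?thesis
      unfolding s using S'
      apply (intro wp_Block)
       apply simp
       apply (intro conjI exI[of _ "q @ [d]"] exI[of _ p'] digits loc'')
              apply (auto simp: flag p'_def const)
      done
  qed
  note step = this
  note main = wp_Seq_assert[OF wp_search[OF S start(1) loc start(2-4)] step order_refl]
  show ?thesis
    unfolding digit_com_def
  proof (rule wp_Seq_exact[OF _ main])
    show "wp S (Block [Const 25 31, Add 25 25 11, Sub 25 25 15, Load 26 25, Sub 16 26 4, Const 17 1]) 6
        (\<lambda>s. s = (f1, os)) (f, os)"
      using reg load S' by (intro wp_Block) (simp_all add: f1_def)
  qed simp_all
qed

lemma wp_symbol:
  assumes S: "31 + n \<le> S" and f: "constants f" "f 3 = r" and r: "1 \<le> r" "r \<le> len"
  shows "wp S symbol_com (n * (k * (12 * exp_bound + 37) + 23) + 18) (\<lambda>(f', os').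
    os' = os @ [ucycle k n w ! (len - r)] \<and> constants f' \<and> f' 10 = f 10 - 1 \<and>
    f' 3 = (if r = 1 then len else r - 1)) (f, os)"
proof -
  let ?Q = "\<lambda>(f', os'). os' = os @ [ucycle k n w ! (len - r)] \<and> constants f' \<and> f' 10 = f 10 - 1 \<and>
    f' 3 = (if r = 1 then len else r - 1)"
  \<comment> \<open>Register 18 holds the count for the current prefix only once a digit has been
    found, hence the guard \<open>i < n\<close>.\<close>
  let ?I = "\<lambda>i (f', os'). os' = os \<and> f' 3 = r \<and> f' 10 = f 10 \<and> f' 29 = i \<and>
    (\<exists>q p. length q = n - i \<and> i \<le> n \<and> digits q p f' \<and> located k n w r q p \<and>
      (i < n \<longrightarrow> f' 18 = count_gt k n w q))"
  have S': "j < S" if "j \<le> 30" for j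
    using S that by simp
  define f1 where "f1 = f(11 := 0, 12 := 0, 13 := 0, 14 := 0, 15 := 1, 29 := n)"
  have loop: "wp S (While 29 digit_com) (n * (k * (12 * exp_bound + 37) + 23) + 1) (?I 0) (f1, os)"
  proof (rule wp_While[where I = ?I and N = n and T = "k * (12 * exp_bound + 37) + 21"])
    have "digits [] 1 f1"
      using f(1) by (simp add: digits_def f1_def constants_def numer_denom_Nil)
    moreover have "located k n w r [] 1"
      using located_Nil r by (simp add: len_def)
    ultimately show "?I n (f1, os)"
      using f(2) by (auto simp: f1_def intro!: exI[of _ "[]"])
  next
    fix i s assume "?I i s" "fst s 29 = 0"
    then show "?I 0 s"
      by (cases s) auto
  next
    fix i s assume I: "?I i s" and nz: "fst s 29 \<noteq> 0"
    obtain f' os' where s: "s = (f', os')"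
      by (cases s)
    obtain q p where q: "length q = n - i" "i \<le> n" "digits q p f'" "located k n w r q p" and f': "f' 3 = r" "f' 10 = f 10"
      and i: "0 < i" "os' = os"
      using I nz unfolding s by auto
    have "length q < n"
      using q i n by simp
    then have "wp S digit_com (k * (12 * exp_bound + 37) + 21) (?I (i - 1)) s"
      unfolding s
    proof (rule wp_mono[OF wp_digit[OF S q(3) _ q(4) f'(1)] order_refl])
      fix s' :: state
      assume post: "case s' of (g, os'') \<Rightarrow> os'' = os' \<and> g 3 = r \<and> g 10 = f' 10 \<and>
        g 29 = n - Suc (length q) \<and> (\<exists>q' p'. length q' = Suc (length q) \<and> digits q' p' g \<and>
          located k n w r q' p' \<and> g 18 = count_gt k n w q')"
      obtain g os'' where s': "s' = (g, os'')"
        by (cases s')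
      obtain q' p' where q': "length q' = Suc (length q)" "digits q' p' g" "located k n w r q' p'"
          "g 18 = count_gt k n w q'"
        using post unfolding s' by auto
      have "length q' = n - (i - 1)" "n - Suc (length q) = i - 1"
        using q(1,2) q'(1) i(1) by auto
      then show "?I (i - 1) s'"
        using post q' q(2) i f' unfolding s' by auto
    qed
    then show "0 < i \<and> wp S digit_com (k * (12 * exp_bound + 37) + 21) (?I (i - 1)) s"
      using i by simp
  qed (use S in auto)
  have "wp S (Block [Const 25 31, Add 25 25 0, Add 25 25 18, Sub 25 25 3, Load 24 25, Write 24,
       Sub 3 3 4, Sub 25 4 3, Mult 25 25 9, Add 3 3 25, Sub 10 10 4]) 11 ?Q s" if I: "?I 0 s" for s
  proof -
    obtain f' os' where s': "s = (f', os')"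
      by (cases s)
    obtain q p where s: "s = (f', os)" and q: "length q = n" "digits q p f'" "located k n w r q p"
      and f': "f' 3 = r" "f' 10 = f 10" "f' 18 = count_gt k n w q"
      using I n unfolding s' by auto
    have less: "count_gt k n w q < r"
      using q(3) by (simp add: located_def)
    have nth: "ucycle k n w ! (len - r) = q ! (n + count_gt k n w q - r)"
      using located_ucycle_nth(2)[OF q(3,1)] n by (simp add: len_def)
    have r_le: "r \<le> n + count_gt k n w q"
      using located_ucycle_nth(1)[OF q(3,1)] n by simp
    define j where "j = n + count_gt k n w q - r"
    have j: "31 + n + count_gt k n w q - r = 31 + j" "j < n" "31 + j < S"
      using r_le less S by (auto simp: j_def)
    have "f' (31 + j) = q ! j"
      using q j(2) by (simp add: digits_def)
    then have load: "f' (31 + n + count_gt k n w q - r) = ucycle k n w ! (len - r)"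
      by (simp only: j(1) nth j_def)
    have bound: "31 + n + count_gt k n w q - r < S" "31 + n + count_gt k n w q - r \<noteq> 25"
      using j by simp_all
    have c: "constants f'"
      using q by (simp add: digits_def)
    then have reg: "f' 0 = n" "f' 4 = 1" "f' 9 = len"
      by (simp_all add: constants_def)
    \<comment> \<open>Moving one position on lowers \<open>r\<close> by 1; at the last position,
      \<open>r = 1\<close>, the second summand wraps around to the start of the cycle.\<close>
    have rem: "r - Suc 0 + (Suc 0 - (r - Suc 0)) * len = (if r = 1 then len else r - 1)"
      using r by auto
    have const: "constants g" if "\<And>x. x < 10 \<and> x \<noteq> 3 \<or> x \<in> {27, 30} \<Longrightarrow> g x = f' x" for g
      using that c by (auto simp: constants_def)
    show ?thesis
      unfolding s using S' f' reg load bound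
      apply (intro wp_Block)
       apply (simp add: rem)
       apply (intro conjI impI const)
        apply auto
      done
  qed
  note main = wp_Seq_assert[OF loop this order_refl]
  show ?thesis
    unfolding symbol_com_def
  proof (rule wp_Seq_exact[OF _ main])
    show "wp S (Block [Const 11 0, Const 12 0, Const 13 0, Const 14 0, Const 15 1, Copy 29 0]) 6
        (\<lambda>s. s = (f1, os)) (f, os)"
      using f S' by (intro wp_Block) (simp_all add: f1_def constants_def)
  qed simp_all
qed

lemma wp_unrank:
  assumes S: "31 + n \<le> S" and w: "w \<le> k * n" and f: "f 0 = n" "f 1 = k" "f 2 = w" "f 3 = r"
    and r: "1 \<le> r" "r \<le> len"
  shows "wp S unrank_com (24 * exp_bound + n * (n * (k * (12 * exp_bound + 37) + 23) + 20) + 51)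
    (\<lambda>s. snd s = cyclic_substring (ucycle k n w) r n) (f, [])"
proof -
  let ?g = "\<lambda>i. ucycle k n w ! ((r - 1 + i) mod len)"
  let ?I = "\<lambda>i (f, os). constants f \<and> f 10 = i \<and> i \<le> n \<and> f 3 = len - (r - 1 + (n - i)) mod len \<and>
    os = map ?g [0..<n - i]"
  have loop: "wp S (While 10 symbol_com) (n * (n * (k * (12 * exp_bound + 37) + 23) + 20) + 1) (?I 0) s"
    if "?I n s" for s
  proof (rule wp_While[where I = ?I and N = n and T = "n * (k * (12 * exp_bound + 37) + 23) + 18"])
    show "?I n s"
      by (fact that)
  next
    fix i s assume "?I i s" "fst s 10 = 0"
    then show "?I 0 s"
      by (cases s) auto
  next
    fix i s assume I: "?I i s" and nz: "fst s 10 \<noteq> 0"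
    obtain f os where s: "s = (f, os)"
      by (cases s)
    define x where "x = (r - 1 + (n - i)) mod len"
    have I': "constants f" "f 10 = i" "i \<le> n" "f 3 = len - x" "os = map ?g [0..<n - i]" "0 < i"
      using I nz by (simp_all add: s x_def)
    have x: "x < len"
      using r by (simp add: x_def)
    have Suc_i: "n - (i - 1) = Suc (n - i)"
      using I' by simp
    have next_x: "(r - 1 + (n - (i - 1))) mod len = (if Suc x = len then 0 else Suc x)"
      unfolding Suc_i x_def add_Suc_right by (rule mod_Suc)
    have "wp S symbol_com (n * (k * (12 * exp_bound + 37) + 23) + 18) (?I (i - 1)) (f, os)"
    proof (rule wp_mono[OF wp_symbol[OF S I'(1,4)] order_refl])
      fix s' :: state
      assume post: "case s' of (f', os') \<Rightarrow> os' = os @ [ucycle k n w ! (len - (len - x))] \<and> constants f' \<and>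
        f' 10 = f 10 - 1 \<and> f' 3 = (if len - x = 1 then len else len - x - 1)"
      obtain f' os' where s': "s' = (f', os')"
        by (cases s')
      have post': "os' = os @ [ucycle k n w ! x]" "constants f'" "f' 10 = i - 1"
          "f' 3 = (if Suc x = len then len else len - Suc x)"
        using post x I'(2) by (auto simp: s')
      have "os' = map ?g [0..<Suc (n - i)]"
        using post'(1) I'(5) by (simp add: x_def)
      moreover have "f' 3 = len - (r - 1 + (n - (i - 1))) mod len"
        unfolding next_x using post'(4) by simp
      ultimately show "?I (i - 1) s'"
        using post'(2,3) I'(3) unfolding s' Suc_i by simp
    qed (use x in auto)
    then show "0 < i \<and> wp S symbol_com (n * (k * (12 * exp_bound + 37) + 23) + 18) (?I (i - 1)) s"
      using I'(6) by (simp only: s simp_thms)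
  qed (use S in auto)
  have len: "length (ucycle k n w) = len"
    using length_ucycle n by (simp add: len_def)
  have prepare: "wp S prepare_com (24 * exp_bound + 50) (?I n) (f, [])"
    using r f by (intro wp_prepare[OF S w f(1,2,3)]) auto
  have "wp S unrank_com (24 * exp_bound + n * (n * (k * (12 * exp_bound + 37) + 23) + 20) + 51) (?I 0) (f, [])"
    unfolding unrank_com_def by (rule wp_Seq_assert[OF prepare loop]) simp_all
  then show ?thesis
    by (rule wp_mono) (auto simp: cyclic_substring_def len)
qed

text \<open>After expansion every monomial is at most \<open>n ^ 4 * k ^ 2\<close>, and the
  coefficients sum to 383.\<close>

lemma unrank_time_bound:
  "24 * exp_bound + n * (n * (k * (12 * exp_bound + 37) + 23) + 20) + 51 \<le> 400 * (n ^ 4 * k ^ 2)"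
proof -
  define M where "M = n ^ 4 * k ^ 2"
  have pow: "n ^ i * k ^ j \<le> M" if "i \<le> 4" "j \<le> 2" for i j
    unfolding M_def using that n k by (intro mult_mono power_increasing) auto
  have "24 * exp_bound + n * (n * (k * (12 * exp_bound + 37) + 23) + 20) + 51 =
      48 * (n ^ 1 * k ^ 1) + 24 * (n ^ 3 * k ^ 2) + 97 * (n ^ 2 * k ^ 1) + 23 * (n ^ 2 * k ^ 0) +
      20 * (n ^ 1 * k ^ 0) + 171 * (n ^ 0 * k ^ 0)"
    by (simp add: exp_bound_def algebra_simps power2_eq_square power3_eq_cube)
  then show ?thesis
    using pow[of 1 1] pow[of 3 2] pow[of 2 1] pow[of 2 0] pow[of 1 0] pow[of 0 0] M_def by linarith
qed

end

theorem theorem2: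
  shows "\<exists>(P :: program) (C :: real) (D :: real). \<forall>(n :: nat) (k :: nat) (w :: nat).
    k < w \<and> w < k * n \<longrightarrow>
    (\<forall>r :: nat. 1 \<le> r \<and> r \<le> card (strings_ge k n w) \<longrightarrow>
      (\<exists>t s. computes_in P [n, k, w, r] (cyclic_substring (ucycle k n w) r n) t s \<and>
        real t \<le> C * (real n ^ 4 * real k ^ 2 * max 1 (log 2 (real k))) \<and>
        real s \<le> D * (real n ^ 3 * real k)))"
proof (rule exI[of _ "compile unrank_com 0"], rule exI[of _ 400], rule exI[of _ 32], intro allI impI, elim conjE)
  fix n k w r :: nat
  assume kw: "k < w" "w < k * n" and r: "1 \<le> r" "r \<le> card (strings_ge k n w)"
  have k: "1 \<le> k" and n: "1 \<le> n"
    using kw by (cases k; cases n; simp)+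
  interpret cycle_params n k w
    using k n by unfold_locales
  \<comment> \<open>Registers 0 to 30 have fixed roles, and the \<open>n\<close> digits of the
    prefix follow; \<open>31 + n \<le> 32 * (n ^ 3 * k)\<close> then explains the constant
    32.\<close>
  have "wp (31 + n) unrank_com (24 * exp_bound + n * (n * (k * (12 * exp_bound + 37) + 23) + 20) + 51)
      (\<lambda>s. snd s = cyclic_substring (ucycle k n w) r n) (regs (init [n, k, w, r]), [])"
    using kw r by (intro wp_unrank) (auto simp: init_def len_def)
  from wp_computes_in[OF this] obtain t where "t \<le> 24 * exp_bound + n * (n * (k * (12 * exp_bound + 37) + 23) + 20) + 51"
    and t: "computes_in (compile unrank_com 0) [n, k, w, r] (cyclic_substring (ucycle k n w) r n) t (31 + n)"
    by auto
  then have le: "t \<le> 400 * (n ^ 4 * k ^ 2)"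
    using unrank_time_bound by linarith
  have "real t \<le> real (400 * (n ^ 4 * k ^ 2))"
    using le by (simp only: of_nat_le_iff)
  also have "\<dots> = 400 * (real n ^ 4 * real k ^ 2 * 1)"
    by simp
  also have "\<dots> \<le> 400 * (real n ^ 4 * real k ^ 2 * max 1 (log 2 (real k)))"
    by (intro mult_left_mono) auto
  finally have "real t \<le> 400 * (real n ^ 4 * real k ^ 2 * max 1 (log 2 (real k)))" .
  moreover have "real (31 + n) \<le> 32 * (real n ^ 3 * real k)"
  proof -
    have "1 * 1 \<le> n ^ 3 * k" "n * 1 \<le> n ^ 3 * k"
      using n k self_le_power[of n 3] by (intro mult_mono; simp)+
    then have "31 + n \<le> 32 * (n ^ 3 * k)"
      by linarith
    then have "real (31 + n) \<le> real (32 * (n ^ 3 * k))"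
      by (simp only: of_nat_le_iff)
    then show ?thesis
      by simp
  qed
  ultimately show "\<exists>t s. computes_in (compile unrank_com 0) [n, k, w, r] (cyclic_substring (ucycle k n w) r n) t s \<and>
        real t \<le> 400 * (real n ^ 4 * real k ^ 2 * max 1 (log 2 (real k))) \<and>
        real s \<le> 32 * (real n ^ 3 * real k)"
    using t by blast
qed

end
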